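(* Let $X_1,\ldots,X_n$ be independent centered random vectors in $\mathbb{R}^d$ with densities and with identity covariance matrix, such that each $X_i$ has a Stein matrix $\tau_i(X_i)$ and a score function $\rho_i(X_i)$. Let $W_n=\frac{1}{\sqrt{n}}\sum_{i=1}^n X_i=((W_n)^1,\ldots,(W_n)^d)^T$. Then $$J_{st}(W_n)=\sum_{j=1}^d\ \sup_{\varphi\in\mathcal{H}(W_n)}\left(E\left[\partial_j\varphi(W_n)-(W_n)^j\varphi(W_n)\right]\right)^2,$$ where each supremum is taken over the collection $\mathcal{H}(W_n)$ of real-valued functions $\varphi$ such that $E[\varphi(W_n)]=0$ and $E[\varphi(W_n)^2]\le 1$.
   Context: Densities are with respect to Lebesgue measure. Vectors in $\mathbb{R}^d$ are $d\times 1$ columns, $\cdot^T$ is the transpose, $\mathrm{tr}$ the trace, $\nabla$ the gradient, and $\partial_j$ the partial derivative in the $j$-th coordinate. The score of a random vector $X$ is the random vector $\rho_X(X)$ satisfying $E[\rho_X(X)\varphi(X)]=-E[\nabla\varphi(X)]$ for all real-valued test functions $\varphi\in C_c^\infty(\mathbb{R}^d)$. A Stein matrix of $X$ is any random $d\times d$ matrix $\tau_X(X)$ satisfying $E[\tau_X(X)\nabla\varphi(X)]=E[X\varphi(X)]$ for all real-valued test functions $\varphi\in C_c^\infty(\mathbb{R}^d)$. Here $\rho_i=\rho_{X_i}$ and $\tau_i=\tau_{X_i}$. For a centered random vector $V$ with invertible covariance $B$ and score $\rho_V(V)$, the relative Fisher information matrix is $\mathcal{J}(V)=E[(\rho_V(V)+B^{-1}V)(\rho_V(V)+B^{-1}V)^T]$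 and the standardised Fisher information distance is $J_{st}(V)=\mathrm{tr}(B\,\mathcal{J}(V))$. $\mathcal{H}(Y)$ denotes the collection of real-valued functions $\varphi$ such that $E[\varphi(Y)]=0$ and $E[\varphi(Y)^2]\le 1$.
   Formalization: Each score ρ_i(X_i) is additionally assumed to be integrable; with only the test-function identity W_n may have no score, so that J_st(W_n) would be undefined. *)

theory Defs
  imports "HOL-Probability.Probability"
begin

definition partial_deriv :: "'d::finite \<Rightarrow> (real^'d \<Rightarrow> real) \<Rightarrow> real^'d \<Rightarrow> real" where
  "partial_deriv j \<phi> x = frechet_derivative \<phi> (at x) (axis j 1)"

definition grad :: "(real^'d \<Rightarrow> real) \<Rightarrow> real^'d::finite \<Rightarrow> real^'d" where
  "grad \<phi> x = (\<chi> j. partial_deriv j \<phi> x)"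

primrec C_k :: "nat \<Rightarrow> (real^'d::finite \<Rightarrow> real) \<Rightarrow> bool" where
  "C_k 0 \<phi> \<longleftrightarrow> continuous_on UNIV \<phi>"
| "C_k (Suc k) \<phi> \<longleftrightarrow> (\<forall>x. \<phi> differentiable (at x)) \<and> (\<forall>j. C_k k (partial_deriv j \<phi>))"

definition test_function :: "(real^'d::finite \<Rightarrow> real) \<Rightarrow> bool" where
  "test_function \<phi> \<longleftrightarrow> (\<forall>k. C_k k \<phi>) \<and> compact (closure {x. \<phi> x \<noteq> 0})"

text \<open>Scores and Stein matrices are represented by the underlying Borel functions \<open>\<rho>\<close> and \<open>\<tau>\<close>.
  The score \<open>\<rho> (X \<omega>)\<close> is a random vector with finite expectation; this is what makes a sum of
  independent vectors with scores have a score again (a conditional expectation). For a Stein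
  matrix it is enough here that the defining expectations exist.\<close>

definition is_score :: "'a measure \<Rightarrow> ('a \<Rightarrow> real^'d::finite) \<Rightarrow> (real^'d \<Rightarrow> real^'d) \<Rightarrow> bool" where
  "is_score M X \<rho> \<longleftrightarrow>
     \<rho> \<in> borel_measurable borel \<and>
     integrable M (\<lambda>\<omega>. \<rho> (X \<omega>)) \<and>
     (\<forall>\<phi>. test_function \<phi> \<longrightarrow>
        integral\<^sup>L M (\<lambda>\<omega>. \<phi> (X \<omega>) *\<^sub>R \<rho> (X \<omega>)) = - integral\<^sup>L M (\<lambda>\<omega>. grad \<phi> (X \<omega>)))"

definition is_stein_matrix ::
    "'a measure \<Rightarrow> ('a \<Rightarrow> real^'d::finite) \<Rightarrow> (real^'d \<Rightarrow> real^'d^'d) \<Rightarrow> bool" where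
  "is_stein_matrix M X \<tau> \<longleftrightarrow>
     \<tau> \<in> borel_measurable borel \<and>
     (\<forall>\<phi>. test_function \<phi> \<longrightarrow>
        integrable M (\<lambda>\<omega>. \<tau> (X \<omega>) *v grad \<phi> (X \<omega>)) \<and>
        integral\<^sup>L M (\<lambda>\<omega>. \<tau> (X \<omega>) *v grad \<phi> (X \<omega>)) = integral\<^sup>L M (\<lambda>\<omega>. \<phi> (X \<omega>) *\<^sub>R X \<omega>))"

text \<open>A score is determined up to null sets of the law of \<open>X\<close>, so the choice is immaterial.\<close>

definition score :: "'a measure \<Rightarrow> ('a \<Rightarrow> real^'d::finite) \<Rightarrow> real^'d \<Rightarrow> real^'d" where
  "score M X = (SOME \<rho>. is_score M X \<rho>)"

text \<open>The matrix \<open>u v\<^sup>T\<close>.\<close>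

definition outer :: "real^'d \<Rightarrow> real^'d \<Rightarrow> real^'d^'d" where
  "outer u v = (\<chi> i j. u $ i * v $ j)"

definition covariance_matrix :: "'a measure \<Rightarrow> ('a \<Rightarrow> real^'d::finite) \<Rightarrow> real^'d^'d" where
  "covariance_matrix M X =
     integral\<^sup>L M (\<lambda>\<omega>. outer (X \<omega> - integral\<^sup>L M X) (X \<omega> - integral\<^sup>L M X))"

definition fisher_integrand :: "'a measure \<Rightarrow> ('a \<Rightarrow> real^'d::finite) \<Rightarrow> 'a \<Rightarrow> real^'d^'d" where
  "fisher_integrand M V \<omega> =
     (let Z = score M V (V \<omega>) + matrix_inv (covariance_matrix M V) *v V \<omega> in outer Z Z)"

definition rel_fisher_info :: "'a measure \<Rightarrow> ('a \<Rightarrow> real^'d::finite) \<Rightarrow> real^'d^'d" where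
  "rel_fisher_info M V = integral\<^sup>L M (fisher_integrand M V)"

text \<open>With \<open>Z = \<rho>\<^sub>V(V) + B\<^sup>-\<^sup>1 V\<close>, the distance is the expectation of the nonnegative variable
  \<open>Z\<^sup>T B Z\<close>, which is infinite exactly when \<open>Z Z\<^sup>T\<close> is not integrable (\<open>B\<close> is positive definite).\<close>

definition J_st :: "'a measure \<Rightarrow> ('a \<Rightarrow> real^'d::finite) \<Rightarrow> ereal" where
  "J_st M V =
     (if integrable M (fisher_integrand M V)
      then ereal (trace (covariance_matrix M V ** rel_fisher_info M V))
      else \<infinity>)"

text \<open>The real-valued functions \<open>\<phi>\<close> with \<open>E[\<phi>(Y)] = 0\<close> and \<open>E[\<phi>(Y)\<^sup>2] \<le> 1\<close>, restricted only by
  what is needed for \<open>\<partial>\<^sub>j\<phi>\<close> and \<open>E[\<partial>\<^sub>j\<phi>(Y)]\<close> to be defined. Integrability has to be stated since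
  Bochner integrals of nonintegrable functions are \<open>0\<close>.\<close>

definition H_class :: "'a measure \<Rightarrow> ('a \<Rightarrow> real^'d::finite) \<Rightarrow> (real^'d \<Rightarrow> real) set" where
  "H_class M Y = {\<phi>. (\<forall>x. \<phi> differentiable (at x)) \<and>
     (\<forall>j. integrable M (\<lambda>\<omega>. partial_deriv j \<phi> (Y \<omega>))) \<and>
     integrable M (\<lambda>\<omega>. (\<phi> (Y \<omega>))\<^sup>2) \<and>
     integral\<^sup>L M (\<lambda>\<omega>. \<phi> (Y \<omega>)) = 0 \<and>
     integral\<^sup>L M (\<lambda>\<omega>. (\<phi> (Y \<omega>))\<^sup>2) \<le> 1}"

definition normalized_sum :: "nat \<Rightarrow> (nat \<Rightarrow> 'a \<Rightarrow> real^'d::finite) \<Rightarrow> 'a \<Rightarrow> real^'d" where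
  "normalized_sum n X \<omega> = (1 / sqrt (real n)) *\<^sub>R (\<Sum>i=1..n. X i \<omega>)"

end

(*
  Put Z = rho(W) + W, so that J_st(W) is the sum over j of E[Z_j^2]. It suffices to show that the
  j-th supremum is E[Z_j^2], or infinity if Z_j is not square integrable.

  "At least": for test functions phi the defining property of the score turns
  E[d_j phi(W) - W^j phi(W)] into -E[Z_j phi(W)], and bounded test functions approximate the
  truncations of Z_j almost everywhere.

  "At most": the same identity has to be extended from test functions to every phi in the class,
  whose partial derivatives are only integrable against the law of W. The density f of W has the
  weak derivative rho_j f, hence it is absolutely continuous on almost every line in direction j.
  On such a line integration by parts holds on each component of {f > 0}, because phi f vanishes at
  the ends of the component. Cauchy-Schwarz then gives the bound.
*)
theory Submission
  imports Defs
begin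

section \<open>Test functions\<close>

text \<open>A member \<phi> of the class is differentiable everywhere but need not be C^1, and its
  derivative need not be locally integrable where the density vanishes. Regularity is therefore
  taken from the density rather than from \<phi>: the density has an absolutely continuous
  representative on lines, and the gauge-integral form of the fundamental theorem copes with \<phi>.
  The score is only known to be integrable, so both sides are compared as extended reals, and second
  moments of truncations of Z_j are bounded by the supremum uniformly in the truncation level. A
  test function u enters the class as (u - E[u(W)]) / a; centring costs nothing because W has mean
  zero. W inherits a score and a density from X_1, which is independent of the remaining sum. The
  score of W is the conditional expectation of sqrt n times the score of X_1, the factor coming from
  the chain rule for the scaling by 1 / sqrt n.\<close>

lemma partial_deriv_eq:
  assumes "(f has_derivative f') (at x)"
  shows "partial_deriv j f x = f' (axis j 1)"
  using frechet_derivative_at[OF assms] by (simp add: partial_deriv_def)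

lemma differentiable_has_frechet_derivative:
  "f differentiable (at x) \<Longrightarrow> (f has_derivative frechet_derivative f (at x)) (at x)"
  by (simp add: frechet_derivative_works)

text \<open>With \<open>p = 1\<close> this is the standard flat function; the family is closed under
  differentiation.\<close>

definition flat_fun :: "real poly \<Rightarrow> real \<Rightarrow> real" where
  "flat_fun p t = (if t > 0 then poly p (1/t) * exp (- (1/t)) else 0)"

text \<open>With s = 1/t one has ds/dt = -s^2, so p(s) exp(-s) has t-derivative s^2 (p(s) - p'(s))
  exp(-s); the factor \<open>[:0,0,1:]\<close> is s^2.\<close>

definition flat_deriv :: "real poly \<Rightarrow> real poly" where
  "flat_deriv p = [:0,0,1:] * (p - pderiv p)"

lemma poly_exp_tendsto_0: "((\<lambda>x. poly p x * exp (- x)) \<longlongrightarrow> (0::real)) at_top"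
proof -
  have "((\<lambda>x. \<Sum>i\<le>degree p. coeff p i * (x ^ i / exp x)) \<longlongrightarrow> (\<Sum>i\<le>degree p. coeff p i * 0)) at_top"
    by (intro tendsto_intros tendsto_power_div_exp_0)
  moreover have "(\<Sum>i\<le>degree p. coeff p i * (x ^ i / exp x)) = poly p x * exp (- x)" for x :: real
    by (simp add: poly_altdef sum_distrib_right exp_minus divide_inverse mult.assoc)
  ultimately show ?thesis by simp
qed

text \<open>From the right, t = 1/s turns the claim into the decay of p(s) exp(-s) at infinity; on
  the left the function is identically zero.\<close>

lemma flat_fun_tendsto_0: "(flat_fun p \<longlongrightarrow> 0) (at 0)"
proof -
  have "((\<lambda>t. poly p (inverse t) * exp (- inverse t)) \<longlongrightarrow> 0) (at_right 0)"
    by (rule filterlim_compose[OF poly_exp_tendsto_0 filterlim_inverse_at_top_right])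
  then have "(flat_fun p \<longlongrightarrow> 0) (at_right 0)"
    by (rule Lim_transform_eventually)
       (auto simp: flat_fun_def eventually_at_right_field divide_inverse intro: exI[of _ 1])
  moreover have "(flat_fun p \<longlongrightarrow> 0) (at_left 0)"
    by (rule Lim_transform_eventually[OF tendsto_const])
       (auto simp: flat_fun_def eventually_at_left_field intro: exI[of _ "-1"])
  ultimately show ?thesis
    by (simp add: filterlim_at_split)
qed

lemma flat_fun_deriv: "(flat_fun p has_real_derivative flat_fun (flat_deriv p) t) (at t)"
proof -
  consider "t > 0" | "t < 0" | "t = 0" by linarith
  then show ?thesis
  proof cases
    case 1
    have "((\<lambda>t. poly p (1/t) * exp (- (1/t))) has_real_derivative
        poly (pderiv p) (1/t) * (- 1 / t^2) * exp (- (1/t)) + poly p (1/t) * (exp (- (1/t)) * (1 / t^2))) (at t)"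
      using 1 by (auto intro!: derivative_eq_intros DERIV_chain2[OF poly_DERIV] simp: power2_eq_square field_simps)
    moreover have "poly (pderiv p) (1/t) * (- 1 / t^2) * exp (- (1/t)) + poly p (1/t) * (exp (- (1/t)) * (1 / t^2))
        = flat_fun (flat_deriv p) t"
      using 1 by (simp add: flat_fun_def flat_deriv_def power2_eq_square field_simps)
    ultimately have "((\<lambda>t. poly p (1/t) * exp (- (1/t))) has_real_derivative flat_fun (flat_deriv p) t) (at t)"
      by simp
    then show ?thesis
      by (rule has_field_derivative_transform_within_open[where S="{0<..}"]) (use 1 in \<open>auto simp: flat_fun_def\<close>)
  next
    case 2
    have "((\<lambda>t. 0) has_real_derivative flat_fun (flat_deriv p) t) (at t)"
      using 2 by (auto simp: flat_fun_def)
    then show ?thesis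
      by (rule has_field_derivative_transform_within_open[where S="{..<0}"]) (use 2 in \<open>auto simp: flat_fun_def\<close>)
  next
    case 3
    \<comment> \<open>Dividing by h multiplies the polynomial by its variable 1/h, so the difference
      quotient at 0 is again a flat function and tends to 0.\<close>
    have "flat_fun p (0 + h) - flat_fun p 0 = flat_fun ([:0,1:] * p) h * h" for h
      by (simp add: flat_fun_def)
    then have "(flat_fun p (0 + h) - flat_fun p 0) / h = flat_fun ([:0,1:] * p) h" if "h \<noteq> 0" for h
      using that by simp
    then have "((\<lambda>h. (flat_fun p (0 + h) - flat_fun p 0) / h) \<longlongrightarrow> 0) (at 0)"
      by (intro Lim_transform_eventually[OF flat_fun_tendsto_0[of "[:0,1:] * p"]])
         (simp add: eventually_at_filter)
    then have "(flat_fun p has_real_derivative 0) (at 0)"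
      by (simp add: DERIV_def)
    then show ?thesis using 3 by (simp add: flat_fun_def)
  qed
qed

section \<open>An algebra of smooth functions closed under partial derivatives\<close>

text \<open>Smoothness is reduced to membership. The generators \<open>flat\<close> depend on x only
  through c - |x|^2, so their partial derivatives are again flat functions times -2 x_j. Hence the
  algebra is closed under partial derivatives, and induction on k puts each member into every
  \<open>C_k\<close>.\<close>

inductive smooth_alg :: "(real^'d::finite \<Rightarrow> real) \<Rightarrow> bool" where
  const: "smooth_alg (\<lambda>x. c)"
| coord: "smooth_alg (\<lambda>x. x $ i)"
| flat: "smooth_alg (\<lambda>x. flat_fun p (c - x \<bullet> x))"
| add: "smooth_alg f \<Longrightarrow> smooth_alg g \<Longrightarrow> smooth_alg (\<lambda>x. f x + g x)"
| mult: "smooth_alg f \<Longrightarrow> smooth_alg g \<Longrightarrow> smooth_alg (\<lambda>x. f x * g x)"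

lemma flat_comp_has_derivative:
  "((\<lambda>x::real^'d::finite. flat_fun p (c - x \<bullet> x)) has_derivative
     (\<lambda>h. flat_fun (flat_deriv p) (c - x \<bullet> x) * (- 2 * (x \<bullet> h)))) (at x)"
proof -
  have "((\<lambda>x::real^'d. c - x \<bullet> x) has_derivative (\<lambda>h. - 2 * (x \<bullet> h))) (at x)"
    by (auto intro!: derivative_eq_intros simp: inner_commute)
  from has_derivative_compose[OF this flat_fun_deriv[of p "c - x \<bullet> x", unfolded has_field_derivative_def]]
  show ?thesis by (simp add: o_def)
qed

lemma coord_has_derivative: "((\<lambda>x. x $ i) has_derivative (\<lambda>h. h $ i)) (at (x::real^'d::finite))"
  by (intro bounded_linear_imp_has_derivative bounded_linear_vec_nth)

lemma smooth_alg_differentiable: "smooth_alg f \<Longrightarrow> f differentiable (at x)"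
  by (induction rule: smooth_alg.induct)
     (auto intro: differentiableI[OF flat_comp_has_derivative] differentiableI[OF coord_has_derivative])

lemma partial_deriv_add:
  "f differentiable (at x) \<Longrightarrow> g differentiable (at x) \<Longrightarrow>
    partial_deriv j (\<lambda>x. f x + g x) x = partial_deriv j f x + partial_deriv j g x"
  unfolding partial_deriv_def
  by (subst frechet_derivative_at[symmetric, OF has_derivative_add[OF differentiable_has_frechet_derivative differentiable_has_frechet_derivative]]) auto

lemma partial_deriv_mult:
  "f differentiable (at x) \<Longrightarrow> g differentiable (at x) \<Longrightarrow>
    partial_deriv j (\<lambda>x. f x * g x) x = f x * partial_deriv j g x + partial_deriv j f x * g x"
  unfolding partial_deriv_def
  by (subst frechet_derivative_at[symmetric, OF has_derivative_mult[OF differentiable_has_frechet_derivative differentiable_has_frechet_derivative]]) auto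

lemma smooth_alg_partial_deriv: "smooth_alg f \<Longrightarrow> smooth_alg (partial_deriv j f)"
proof (induction rule: smooth_alg.induct)
  case (const c)
  have "partial_deriv j (\<lambda>x. c) = (\<lambda>x. 0)"
    by (rule ext, subst partial_deriv_eq[OF has_derivative_const]) simp
  then show ?case by (simp add: smooth_alg.const)
next
  case (coord i)
  have "partial_deriv j (\<lambda>x. x $ i) = (\<lambda>x. axis j 1 $ i)"
    by (rule ext, subst partial_deriv_eq[OF coord_has_derivative]) simp
  then show ?case by (simp add: smooth_alg.const)
next
  case (flat p c)
  have "partial_deriv j (\<lambda>x. flat_fun p (c - x \<bullet> x)) = (\<lambda>x. flat_fun (flat_deriv p) (c - x \<bullet> x) * (- 2 * (x $ j)))"
    by (rule ext, subst partial_deriv_eq[OF flat_comp_has_derivative]) (simp add: inner_axis)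
  then show ?case
    by (simp only:) (intro smooth_alg.intros)
next
  case (add f g)
  have "partial_deriv j (\<lambda>x. f x + g x) = (\<lambda>x. partial_deriv j f x + partial_deriv j g x)"
    using add by (auto simp: partial_deriv_add smooth_alg_differentiable)
  then show ?case using add by (auto intro!: smooth_alg.intros)
next
  case (mult f g)
  have "partial_deriv j (\<lambda>x. f x * g x) = (\<lambda>x. f x * partial_deriv j g x + partial_deriv j f x * g x)"
    using mult by (auto simp: partial_deriv_mult smooth_alg_differentiable)
  then show ?case using mult by (auto intro!: smooth_alg.intros)
qed

lemma smooth_alg_C_k: "smooth_alg f \<Longrightarrow> C_k k f"
  by (induction k arbitrary: f)
     (auto intro: smooth_alg_partial_deriv smooth_alg_differentiable
        intro!: continuous_at_imp_continuous_on differentiable_imp_continuous_within)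

lemma smooth_alg_sum: "(\<And>i. i \<in> I \<Longrightarrow> smooth_alg (f i)) \<Longrightarrow> smooth_alg (\<lambda>x. \<Sum>i\<in>I. f i x)"
  by (induction I rule: infinite_finite_induct) (auto intro: smooth_alg.intros)

text \<open>Stone-Weierstrass produces approximants of this kind. The only generator not visibly in
  the algebra is a bounded linear functional, which is expanded in the standard basis.\<close>

lemma smooth_alg_real_polynomial_function: "real_polynomial_function p \<Longrightarrow> smooth_alg p"
proof (induction rule: real_polynomial_function.induct)
  case (linear f)
  have "f x = (\<Sum>i\<in>UNIV. f (axis i 1) * x $ i)" for x
  proof -
    have "f x = f (\<Sum>i\<in>UNIV. x $ i *\<^sub>R axis i 1)"
      by (simp add: basis_expansion flip: scalar_mult_eq_scaleR)
    then show ?thesis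
      using bounded_linear.linear[OF linear] by (simp add: linear_sum linear_scale mult.commute)
  qed
  then have "f = (\<lambda>x. \<Sum>i\<in>UNIV. f (axis i 1) * x $ i)" by blast
  then show ?case
    by (rule ssubst) (intro smooth_alg_sum smooth_alg.intros)
qed (auto intro: smooth_alg.intros)

text \<open>Inside the ball of radius sqrt c this is exp(-1/(c - |x|^2)), outside it is 0. It never
  reaches the value 1; what replaces a plateau is the pointwise convergence to 1 as c grows.\<close>

definition cutoff :: "real \<Rightarrow> real^'d::finite \<Rightarrow> real" where
  "cutoff c x = flat_fun 1 (c - x \<bullet> x)"

lemma cutoff_nonneg: "0 \<le> cutoff c x" and cutoff_le_1: "cutoff c x \<le> 1"
  by (auto simp: cutoff_def flat_fun_def)

lemma cutoff_eq_0: "c \<le> x \<bullet> x \<Longrightarrow> cutoff c x = 0"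
  by (auto simp: cutoff_def flat_fun_def)

lemma cutoff_tendsto_1: "(\<lambda>n. cutoff (real n) x) \<longlonglongrightarrow> 1"
proof -
  have "((\<lambda>t::real. exp (- inverse t)) \<longlongrightarrow> exp (- 0)) at_top"
    by (intro tendsto_intros tendsto_inverse_0_at_top filterlim_ident)
  moreover have "filterlim (\<lambda>n. real n - x \<bullet> x) at_top sequentially"
    using filterlim_tendsto_add_at_top[OF tendsto_const[of "- (x \<bullet> x)"] filterlim_real_sequentially]
    by simp
  ultimately have "(\<lambda>n. exp (- inverse (real n - x \<bullet> x))) \<longlonglongrightarrow> 1"
    using filterlim_compose by fastforce
  then show ?thesis
  proof (rule Lim_transform_eventually)
    show "\<forall>\<^sub>F n in sequentially. exp (- inverse (real n - x \<bullet> x)) = cutoff (real n) x"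
      using eventually_gt_at_top[of "nat \<lceil>x \<bullet> x\<rceil>"]
      by eventually_elim (auto simp: cutoff_def flat_fun_def inverse_eq_divide, linarith+)
  qed
qed

lemma test_function_cutoff_mult:
  fixes f :: "real^'d::finite \<Rightarrow> real"
  assumes "smooth_alg f"
  shows "test_function (\<lambda>x. cutoff c x * f x)"
proof -
  have "smooth_alg (\<lambda>x. cutoff c x * f x)"
    unfolding cutoff_def by (intro smooth_alg.mult smooth_alg.flat assms)
  moreover have "{x. cutoff c x * f x \<noteq> 0} \<subseteq> cball 0 (sqrt c)"
  proof
    fix x :: "real^'d" assume "x \<in> {x. cutoff c x * f x \<noteq> 0}"
    then have "x \<bullet> x < c" using cutoff_eq_0[of c x] by (cases "c \<le> x \<bullet> x") auto
    then show "x \<in> cball 0 (sqrt c)"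
      by (simp add: norm_eq_sqrt_inner)
  qed
  then have "bounded {x. cutoff c x * f x \<noteq> 0}"
    using bounded_cball bounded_subset by blast
  ultimately show ?thesis
    unfolding test_function_def by (auto simp: smooth_alg_C_k compact_closure)
qed

section \<open>Test functions under affine substitutions\<close>

lemma partial_deriv_affine:
  fixes f :: "real^'d::finite \<Rightarrow> real"
  assumes d: "f differentiable (at (c *\<^sub>R x + v))"
  shows "(\<lambda>x. f (c *\<^sub>R x + v)) differentiable (at x)"
    and "partial_deriv j (\<lambda>x. f (c *\<^sub>R x + v)) x = c * partial_deriv j f (c *\<^sub>R x + v)"
proof -
  have "((\<lambda>x. c *\<^sub>R x + v) has_derivative (\<lambda>h. c *\<^sub>R h)) (at x)"
    by (auto intro!: derivative_eq_intros)
  from has_derivative_compose[OF this differentiable_has_frechet_derivative[OF d]]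
  have D: "((\<lambda>x. f (c *\<^sub>R x + v)) has_derivative (\<lambda>h. frechet_derivative f (at (c *\<^sub>R x + v)) (c *\<^sub>R h))) (at x)"
    by (simp add: o_def)
  show "(\<lambda>x. f (c *\<^sub>R x + v)) differentiable (at x)"
    by (rule differentiableI[OF D])
  show "partial_deriv j (\<lambda>x. f (c *\<^sub>R x + v)) x = c * partial_deriv j f (c *\<^sub>R x + v)"
    using partial_deriv_eq[OF D, of j] linear_scale[OF linear_frechet_derivative[OF d], of c "axis j 1"]
    by (simp add: partial_deriv_def)
qed

lemma C_k_cmult:
  fixes f :: "real^'d::finite \<Rightarrow> real"
  shows "C_k k f \<Longrightarrow> C_k k (\<lambda>x. c * f x)"
proof (induction k arbitrary: f)
  case 0
  then show ?case by (auto intro!: continuous_intros)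
next
  case (Suc k)
  have "partial_deriv j (\<lambda>x. c * f x) = (\<lambda>x. c * partial_deriv j f x)" for j
  proof
    fix x
    have "f differentiable (at x)" using Suc.prems by simp
    from partial_deriv_eq[OF has_derivative_mult_right[OF differentiable_has_frechet_derivative[OF this]]]
    show "partial_deriv j (\<lambda>x. c * f x) x = c * partial_deriv j f x"
      by (simp add: partial_deriv_def)
  qed
  with Suc show ?case by auto
qed

lemma C_k_affine:
  fixes f :: "real^'d::finite \<Rightarrow> real"
  shows "C_k k f \<Longrightarrow> C_k k (\<lambda>x. f (c *\<^sub>R x + v))"
proof (induction k arbitrary: f)
  case 0
  then show ?case
    by (auto intro!: continuous_on_compose2[where f="\<lambda>x. c *\<^sub>R x + v" and s=UNIV and t=UNIV] continuous_intros)
next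
  case (Suc k)
  then have d: "f differentiable (at x)" for x by simp
  have "partial_deriv j (\<lambda>x. f (c *\<^sub>R x + v)) = (\<lambda>x. c * partial_deriv j f (c *\<^sub>R x + v))" for j
    using partial_deriv_affine(2)[OF d] by (rule ext)
  then show ?case
    using Suc partial_deriv_affine(1)[OF d] by (auto intro!: C_k_cmult)
qed

text \<open>Translates (c = 1) serve the increment formula for weak derivatives; general c serves
  the score of a rescaled sum with one summand frozen. The support is carried over by y -> (y - v)/c
  and stays bounded.\<close>

lemma test_function_affine:
  assumes f: "test_function f" and c: "c \<noteq> 0"
  shows "test_function (\<lambda>x. f (c *\<^sub>R x + v))"
proof -
  have "bounded {x. f x \<noteq> 0}"
    using f bounded_subset[OF compact_imp_bounded closure_subset] unfolding test_function_def by blast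
  then have "bounded ((\<lambda>y. (1/c) *\<^sub>R y - (1/c) *\<^sub>R v) ` {x. f x \<noteq> 0})"
    using bounded_translation_minus[OF bounded_scaling[of "{x. f x \<noteq> 0}" "1/c"], of "(1/c) *\<^sub>R v"]
    by (simp add: image_image)
  moreover have "{x. f (c *\<^sub>R x + v) \<noteq> 0} \<subseteq> (\<lambda>y. (1/c) *\<^sub>R y - (1/c) *\<^sub>R v) ` {x. f x \<noteq> 0}"
  proof
    fix x assume "x \<in> {x. f (c *\<^sub>R x + v) \<noteq> 0}"
    then show "x \<in> (\<lambda>y. (1/c) *\<^sub>R y - (1/c) *\<^sub>R v) ` {x. f x \<noteq> 0}"
      using c by (intro image_eqI[where x="c *\<^sub>R x + v"]) (auto simp: algebra_simps)
  qed
  ultimately have "compact (closure {x. f (c *\<^sub>R x + v) \<noteq> 0})"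
    using bounded_subset compact_closure by blast
  then show ?thesis
    using f C_k_affine unfolding test_function_def by blast
qed

lemma test_function_differentiable: "test_function f \<Longrightarrow> f differentiable (at x)"
  using C_k.simps(2)[of 0 f] unfolding test_function_def by blast

section \<open>Bounds and almost-everywhere approximation by test functions\<close>

lemma continuous_bounded_support_imp_bounded:
  fixes f :: "'b::metric_space \<Rightarrow> real"
  assumes "continuous_on UNIV f" "compact S" "\<And>x. x \<notin> S \<Longrightarrow> f x = 0"
  obtains B where "\<And>x. \<bar>f x\<bar> \<le> B"
proof -
  have "bounded (f ` S)"
    using assms by (intro compact_imp_bounded compact_continuous_image) (auto intro: continuous_on_subset)
  then obtain B where "\<And>x. x \<in> S \<Longrightarrow> \<bar>f x\<bar> \<le> B" by (auto simp: bounded_iff)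
  then have "\<bar>f x\<bar> \<le> max B 0" for x
    using assms(3)[of x] by (cases "x \<in> S") (auto simp: max.coboundedI1)
  then show ?thesis using that by blast
qed

text \<open>Both functions are continuous and vanish off a compact set. The common bound is what
  makes their products with integrable functions integrable later.\<close>

lemma test_function_bounds:
  assumes "test_function f"
  obtains B where "continuous_on UNIV f" "continuous_on UNIV (partial_deriv j f)"
    "\<And>x. \<bar>f x\<bar> \<le> B" "\<And>x. \<bar>partial_deriv j f x\<bar> \<le> B"
proof -
  let ?S = "closure {x. f x \<noteq> 0}"
  have S: "compact ?S" and ck: "C_k k f" for k using assms by (auto simp: test_function_def)
  have c1: "continuous_on UNIV f" using ck[of 0] by simp
  have c2: "continuous_on UNIV (partial_deriv j f)" using ck[of 1] by simp
  have f0: "f x = 0" if "x \<notin> ?S" for x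
    using that closure_subset[of "{x. f x \<noteq> 0}"] by auto
  have d0: "partial_deriv j f x = 0" if "x \<notin> ?S" for x
  proof -
    \<comment> \<open>The complement of the closed support is open, so \<open>f\<close> agrees with
      0 in a neighbourhood of \<open>x\<close>.\<close>
    have "(f has_derivative (\<lambda>_. 0)) (at x)"
    proof (rule has_derivative_transform_within_open)
      show "((\<lambda>_. 0) has_derivative (\<lambda>_. 0)) (at x)" by simp
      show "open (- ?S)" "x \<in> - ?S" using that by auto
      show "0 = f y" if "y \<in> - ?S" for y using that f0[of y] by simp
    qed
    from partial_deriv_eq[OF this] show ?thesis by simp
  qed
  obtain B1 where "\<And>x. \<bar>f x\<bar> \<le> B1"
    using continuous_bounded_support_imp_bounded[OF c1 S f0] by blast
  moreover obtain B2 where "\<And>x. \<bar>partial_deriv j f x\<bar> \<le> B2"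
    using continuous_bounded_support_imp_bounded[OF c2 S d0] by blast
  ultimately show ?thesis
    using that[of "max B1 B2"] c1 c2 by (simp add: max.coboundedI1 max.coboundedI2)
qed

text \<open>Unfolding \<open>measurable_on\<close> yields continuous functions that converge off a
  negligible set; that set is null for the completed measure, and the almost-everywhere statement
  descends to \<open>lborel\<close>.\<close>

lemma AE_lborel_tendsto_of_continuous:
  fixes k :: "'b::euclidean_space \<Rightarrow> real"
  assumes k: "k \<in> borel_measurable borel"
  obtains g where "\<And>m::nat. continuous_on UNIV (g m)" "AE x in lborel. (\<lambda>m. g m x) \<longlonglongrightarrow> k x"
proof -
  have "k \<in> borel_measurable lebesgue"
    by (rule measurable_completion) (use k in simp)
  then have "k measurable_on UNIV"
    by (rule lebesgue_measurable_imp_measurable_on) simp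
  then obtain N g where N: "negligible N" and g: "\<And>m. continuous_on UNIV (g m)"
    and lim: "\<And>x. x \<notin> N \<Longrightarrow> (\<lambda>m. g m x) \<longlonglongrightarrow> k x"
    unfolding measurable_on_def by auto
  have "AE x in lebesgue. (\<lambda>m. g m x) \<longlonglongrightarrow> k x"
    using N lim by (intro AE_I'[of N]) (auto simp: negligible_iff_null_sets)
  then have "AE x in lborel. (\<lambda>m. g m x) \<longlonglongrightarrow> k x"
    by (simp add: AE_completion_iff)
  then show ?thesis using that g by blast
qed

text \<open>Continuous approximants are clipped to [-C, C], replaced by polynomials within 1/(m+1)
  on the ball of radius sqrt m, and multiplied by the cutoff that vanishes outside this ball. The
  extra 1 in the bound absorbs the polynomial error.\<close>

lemma test_function_approx:
  fixes k :: "real^'d::finite \<Rightarrow> real"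
  assumes k: "k \<in> borel_measurable borel" and C: "\<And>x. \<bar>k x\<bar> \<le> C"
  obtains u where "\<And>m::nat. test_function (u m)" "\<And>m x. \<bar>u m x\<bar> \<le> C + 1"
    "AE x in lborel. (\<lambda>m. u m x) \<longlonglongrightarrow> k x"
proof -
  obtain g :: "nat \<Rightarrow> real^'d \<Rightarrow> real" where g: "\<And>m. continuous_on UNIV (g m)"
    and lim: "AE x in lborel. (\<lambda>m. g m x) \<longlonglongrightarrow> k x"
    using AE_lborel_tendsto_of_continuous[OF k] by blast
  \<comment> \<open>Clipping keeps the limit, since \<open>k\<close> itself takes values in [-C, C],
    and provides a bound uniform in m.\<close>
  define h where "h m x = max (- C) (min C (g m x))" for m x
  have C0: "0 \<le> C" using C[of 0] by linarith
  have h: "continuous_on S (h m)" for m S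
    unfolding h_def using g by (intro continuous_intros) (auto intro: continuous_on_subset)
  have hC: "\<bar>h m x\<bar> \<le> C" for m x using C0 by (auto simp: h_def abs_le_iff)
  have "\<exists>p. real_polynomial_function p \<and> (\<forall>x\<in>cball 0 (sqrt (real m)). \<bar>h m x - p x\<bar> < 1 / Suc m)" for m
    using Stone_Weierstrass_real_polynomial_function[OF compact_cball h, of "1 / Suc m"] by (metis of_nat_0_less_iff zero_less_Suc zero_less_divide_1_iff)
  then obtain p where p: "\<And>m. real_polynomial_function (p m)"
    "\<And>m x. x \<in> cball 0 (sqrt (real m)) \<Longrightarrow> \<bar>h m x - p m x\<bar> < 1 / Suc m" by metis
  define u where "u m x = cutoff (real m) x * p m x" for m x
  \<comment> \<open>The polynomial is uncontrolled outside the ball, but there the cutoff kills both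
    terms.\<close>
  have near: "\<bar>u m x - cutoff (real m) x * h m x\<bar> \<le> 1 / Suc m" for m x
  proof (cases "real m \<le> x \<bullet> x")
    case True
    then show ?thesis by (simp add: u_def cutoff_eq_0)
  next
    case False
    then have "x \<in> cball 0 (sqrt (real m))" by (simp add: norm_eq_sqrt_inner)
    then have 1: "\<bar>p m x - h m x\<bar> \<le> 1 / Suc m" using p(2)[of x m] by linarith
    have "\<bar>u m x - cutoff (real m) x * h m x\<bar> = cutoff (real m) x * \<bar>p m x - h m x\<bar>"
      using cutoff_nonneg[of "real m" x] by (simp add: u_def abs_mult flip: right_diff_distrib)
    also have "\<dots> \<le> 1 * \<bar>p m x - h m x\<bar>"
      by (intro mult_right_mono cutoff_le_1) auto
    also have "\<dots> \<le> 1 / Suc m" using 1 by simp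
    finally show ?thesis .
  qed
  show ?thesis
  proof (rule that)
    show "test_function (u m)" for m
      unfolding u_def using p(1) by (intro test_function_cutoff_mult smooth_alg_real_polynomial_function)
    show "\<bar>u m x\<bar> \<le> C + 1" for m x
    proof -
      have "\<bar>cutoff (real m) x * h m x\<bar> \<le> 1 * C"
        unfolding abs_mult using cutoff_nonneg[of "real m" x] cutoff_le_1[of "real m" x] hC C0
        by (intro mult_mono) auto
      moreover have "1 / real (Suc m) \<le> 1" by simp
      ultimately show ?thesis using near[of m x] by linarith
    qed
    show "AE x in lborel. (\<lambda>m. u m x) \<longlonglongrightarrow> k x"
      using lim
    proof eventually_elim
      case (elim x)
      have "(\<lambda>m. h m x) \<longlonglongrightarrow> max (- C) (min C (k x))"
        unfolding h_def by (intro tendsto_intros elim)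
      also have "max (- C) (min C (k x)) = k x" using C[of x] by (auto simp: abs_le_iff)
      finally have "(\<lambda>m. cutoff (real m) x * h m x) \<longlonglongrightarrow> 1 * k x"
        by (intro tendsto_intros cutoff_tendsto_1)
      moreover have "(\<lambda>m. u m x - cutoff (real m) x * h m x) \<longlonglongrightarrow> 0"
        by (rule Lim_null_comparison[OF _ LIMSEQ_Suc[OF lim_1_over_n]]) (use near in auto)
      ultimately show ?case
        using tendsto_add by fastforce
    qed
  qed
qed

lemma test_function_borel_measurable: "test_function u \<Longrightarrow> u \<in> borel_measurable borel"
  using test_function_bounds[of u] by (metis borel_measurable_continuous_onI)

lemma integrable_test_function_mult:
  fixes K :: "real^'d::finite \<Rightarrow> real"
  assumes K: "integrable M K" and u: "test_function u" and M: "sets M = sets borel"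
  shows "integrable M (\<lambda>x. u x * K x)" "integrable M (\<lambda>x. partial_deriv j u x * K x)"
proof -
  obtain B where B: "continuous_on UNIV u" "continuous_on UNIV (partial_deriv j u)"
    "\<And>x. \<bar>u x\<bar> \<le> B" "\<And>x. \<bar>partial_deriv j u x\<bar> \<le> B"
    using test_function_bounds[OF u] by metis
  have [measurable]: "u \<in> borel_measurable M" "partial_deriv j u \<in> borel_measurable M"
    using B by (auto simp: measurable_cong_sets[OF M refl] intro!: borel_measurable_continuous_onI)
  have [measurable]: "K \<in> borel_measurable M" using K by auto
  have *: "integrable M (\<lambda>x. B * K x)" using K by simp
  have "\<bar>u x * K x\<bar> \<le> \<bar>B * K x\<bar>" "\<bar>partial_deriv j u x * K x\<bar> \<le> \<bar>B * K x\<bar>" for x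
    using B(3,4)[of x] by (auto simp: abs_mult intro!: mult_right_mono)
  then show "integrable M (\<lambda>x. u x * K x)" "integrable M (\<lambda>x. partial_deriv j u x * K x)"
    by (auto intro!: Bochner_Integration.integrable_bound[OF *])
qed

text \<open>Bounded test functions converging almost everywhere to sgn K turn the hypothesis, by
  dominated convergence, into the vanishing of the integral of |K|.\<close>

lemma AE_0_if_integral_test_function_0:
  fixes K :: "real^'d::finite \<Rightarrow> real"
  assumes K: "integrable lborel K"
    and 0: "\<And>u. test_function u \<Longrightarrow> (\<integral>x. u x * K x \<partial>lborel) = 0"
  shows "AE x in lborel. K x = 0"
proof -
  have [measurable]: "K \<in> borel_measurable borel" using K by auto
  have "(\<lambda>x. sgn (K x)) \<in> borel_measurable borel" by measurable
  moreover have "\<bar>sgn (K x)\<bar> \<le> 1" for x by (auto simp: sgn_if)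
  ultimately obtain u where u: "\<And>m::nat. test_function (u m)" "\<And>m x. \<bar>u m x\<bar> \<le> 1 + 1"
    "AE x in lborel. (\<lambda>m. u m x) \<longlonglongrightarrow> sgn (K x)"
    using test_function_approx[of "\<lambda>x. sgn (K x)" 1] by blast
  note [measurable] = test_function_borel_measurable[OF u(1)]
  have "(\<lambda>m. \<integral>x. u m x * K x \<partial>lborel) \<longlonglongrightarrow> (\<integral>x. sgn (K x) * K x \<partial>lborel)"
  proof (rule integral_dominated_convergence)
    show "integrable lborel (\<lambda>x. 2 * \<bar>K x\<bar>)" using K by auto
    show "AE x in lborel. (\<lambda>m. u m x * K x) \<longlonglongrightarrow> sgn (K x) * K x"
      using u(3) by eventually_elim (intro tendsto_intros)
    show "AE x in lborel. norm (u m x * K x) \<le> 2 * \<bar>K x\<bar>" for m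
      using u(2)[of m] by (auto simp: abs_mult intro!: mult_right_mono)
  qed measurable
  then have "(\<integral>x. \<bar>K x\<bar> \<partial>lborel) = 0"
    using 0[OF u(1)] by (simp add: LIMSEQ_const_iff linordered_idom_class.abs_sgn mult.commute)
  then show ?thesis
    using K by (subst (asm) integral_nonneg_eq_0_iff_AE) auto
qed

section \<open>Integration by parts on the line\<close>

text \<open>A derivative need not be continuous, but it is the pointwise limit of the difference
  quotients with increments 1/(n+1).\<close>

lemma borel_measurable_real_derivative:
  fixes f f' :: "real \<Rightarrow> real"
  assumes f: "\<And>t. (f has_real_derivative f' t) (at t)"
  shows "f' \<in> borel_measurable borel"
proof -
  have "continuous_on UNIV f"
    by (intro continuous_at_imp_continuous_on ballI DERIV_isCont[OF f])
  then have [measurable]: "f \<in> borel_measurable borel"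
    by (rule borel_measurable_continuous_onI)
  show ?thesis
  proof (rule borel_measurable_LIMSEQ_real)
    fix t
    have "((\<lambda>h. (f (t + h) - f t) / h) \<longlongrightarrow> f' t) (at 0)"
      using f[of t] by (simp add: DERIV_def)
    moreover have "filterlim (\<lambda>n. 1 / real (Suc n)) (at 0) sequentially"
      by (auto simp: filterlim_at intro!: LIMSEQ_Suc[OF lim_1_over_n] simp del: of_nat_Suc)
    ultimately show "(\<lambda>n. (f (t + 1 / real (Suc n)) - f t) / (1 / real (Suc n))) \<longlonglongrightarrow> f' t"
      by (rule filterlim_compose)
  qed measurable
qed

text \<open>When x_n tends to a, the indicators of \<open>{..x n}\<close> converge except possibly
  at the point a, and |G| dominates.\<close>

lemma continuous_indefinite_lborel_integral:
  fixes G :: "real \<Rightarrow> real"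
  assumes G: "integrable lborel G"
  shows "continuous_on UNIV (\<lambda>t. \<integral>s. indicator {..t} s * G s \<partial>lborel)"
  unfolding continuous_on_sequentially
proof (intro allI ballI impI, elim conjE)
  fix x :: "nat \<Rightarrow> real" and a
  assume x: "x \<longlonglongrightarrow> a"
  have [measurable]: "G \<in> borel_measurable borel" using G by auto
  have "(\<lambda>n. \<integral>s. indicator {..x n} s * G s \<partial>lborel) \<longlonglongrightarrow> (\<integral>s. indicator {..a} s * G s \<partial>lborel)"
  proof (rule integral_dominated_convergence[where w="\<lambda>s. \<bar>G s\<bar>"])
    show "AE s in lborel. (\<lambda>n. indicator {..x n} s * G s) \<longlonglongrightarrow> indicator {..a} s * G s"
      using AE_lborel_singleton[of a]
    proof eventually_elim
      case (elim s)
      have "\<forall>\<^sub>F n in sequentially. indicator {..x n} s = (indicator {..a} s :: real)"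
      proof (cases "s < a")
        case True
        then show ?thesis using order_tendstoD(1)[OF x True] by (auto elim!: eventually_mono)
      next
        case False
        then have "a < s" using elim by simp
        from order_tendstoD(2)[OF x this] False elim show ?thesis by (auto elim!: eventually_mono)
      qed
      then have "(\<lambda>n. indicator {..x n} s :: real) \<longlonglongrightarrow> indicator {..a} s"
        by (rule tendsto_eventually)
      then show ?case by (intro tendsto_intros)
    qed
  qed (use G in \<open>auto simp: abs_mult indicator_def\<close>)
  then show "((\<lambda>t. \<integral>s. indicator {..t} s * G s \<partial>lborel) \<circ> x) \<longlonglongrightarrow> (\<integral>s. indicator {..a} s * G s \<partial>lborel)"
    by (simp add: o_def)
qed

lemma integrable_indicator_mult:
  fixes f :: "'b::euclidean_space \<Rightarrow> real"
  shows "integrable lborel f \<Longrightarrow> A \<in> sets borel \<Longrightarrow> integrable lborel (\<lambda>x. indicator A x * f x)"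
  using integrable_mult_indicator[of A lborel f] by simp

text \<open>Integrability is given for \<phi>' F, not for \<phi>'. On the compact interval F has a
  positive minimum, and dividing by it makes \<phi>' integrable there. The formula is then Fubini
  for \<phi>'(t) G(s) on the triangle t \<le> s, whose inner integrals are \<phi>(s) - \<phi>(c) and
  F(d) - F(t).\<close>

lemma integral_by_parts_pos:
  fixes F G \<phi> \<phi>' :: "real \<Rightarrow> real"
  assumes G: "integrable lborel G"
    and F: "\<And>t. F t = C + (\<integral>s. indicator {..t} s * G s \<partial>lborel)"
    and \<phi>: "\<And>t. (\<phi> has_real_derivative \<phi>' t) (at t)"
    and i1: "integrable lborel (\<lambda>t. \<phi>' t * F t)"
    and i2: "integrable lborel (\<lambda>t. \<phi> t * G t)"
    and le: "c \<le> d" and pos: "\<And>t. t \<in> {c..d} \<Longrightarrow> F t > 0"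
  shows "(\<integral>t. indicator {c..d} t * (\<phi>' t * F t + \<phi> t * G t) \<partial>lborel) = \<phi> d * F d - \<phi> c * F c"
proof -
  have [measurable]: "G \<in> borel_measurable borel" using G by auto
  have [measurable]: "\<phi>' \<in> borel_measurable borel"
    by (rule borel_measurable_real_derivative[OF \<phi>])
  have contF: "continuous_on UNIV F"
    unfolding F by (intro continuous_intros continuous_indefinite_lborel_integral G)
  have cont\<phi>: "continuous_on UNIV \<phi>"
    by (intro continuous_at_imp_continuous_on ballI DERIV_isCont[OF \<phi>])
  have [measurable]: "\<phi> \<in> borel_measurable borel" "F \<in> borel_measurable borel"
    using contF cont\<phi> by (auto intro: borel_measurable_continuous_onI)
  obtain x where x: "x \<in> {c..d}" "\<And>y. y \<in> {c..d} \<Longrightarrow> F x \<le> F y"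
    using continuous_attains_inf[of "{c..d}" F] le continuous_on_subset[OF contF subset_UNIV]
    by (metis atLeastAtMost_iff compact_Icc empty_iff order_refl)
  define P where "P t = indicator {c..d} t * \<phi>' t" for t
  define Q where "Q t = indicator {c..d} t * G t" for t
  have [measurable]: "P \<in> borel_measurable borel" "Q \<in> borel_measurable borel"
    unfolding P_def Q_def by measurable
  have P: "integrable lborel P"
  proof (rule Bochner_Integration.integrable_bound)
    show "integrable lborel (\<lambda>t. (1 / F x) * (\<phi>' t * F t))" using i1 by simp
    have "norm (P t) \<le> norm ((1 / F x) * (\<phi>' t * F t))" for t
    proof (cases "t \<in> {c..d}")
      case True
      have "\<bar>\<phi>' t\<bar> * 1 \<le> \<bar>\<phi>' t\<bar> * (F t / F x)"
        using x(2)[OF True] pos[OF x(1)] by (intro mult_left_mono) auto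
      then show ?thesis using True pos[OF x(1)] pos[OF True] by (simp add: P_def abs_mult)
    qed (simp add: P_def)
    then show "AE t in lborel. norm (P t) \<le> norm ((1 / F x) * (\<phi>' t * F t))" by simp
  qed simp
  have Q: "integrable lborel Q"
    unfolding Q_def by (intro integrable_indicator_mult G) simp
  have ftc: "(\<integral>t. indicator {c..s} t * \<phi>' t \<partial>lborel) = \<phi> s - \<phi> c" if "s \<in> {c..d}" for s
  proof -
    have "integrable lborel (\<lambda>t. indicator {c..s} t * P t)"
      by (intro integrable_indicator_mult P) simp
    also have "(\<lambda>t. indicator {c..s} t * P t) = (\<lambda>t. indicator {c..s} t * \<phi>' t)"
      using that by (auto simp: P_def indicator_def)
    finally have si: "set_integrable lborel {c..s} \<phi>'"
      by (simp add: set_integrable_def)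
    \<comment> \<open>The gauge integral recovers \<phi> from any derivative that exists everywhere;
      given set integrability it coincides with the Lebesgue integral.\<close>
    have "(\<phi>' has_integral \<phi> s - \<phi> c) {c..s}"
      using that \<phi> by (intro fundamental_theorem_of_calculus)
        (auto simp: has_real_derivative_iff_has_vector_derivative intro: has_vector_derivative_at_within)
    then show ?thesis
      using set_borel_integral_eq_integral(2)[OF si] by (simp add: set_lebesgue_integral_def integral_unique)
  qed
  have dF: "(\<integral>s. indicator {t..d} s * G s \<partial>lborel) = F d - F t" if "t \<le> d" for t
  proof -
    have "F d - F t = (\<integral>s. indicator {..d} s * G s - indicator {..t} s * G s \<partial>lborel)"
      unfolding F by (subst Bochner_Integration.integral_diff) (auto intro!: integrable_indicator_mult G)
    \<comment> \<open>The difference of the two indicators belongs to the half-open interval; the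
      endpoint t is a null set.\<close>
    also have "\<dots> = (\<integral>s. indicator {t..d} s * G s \<partial>lborel)"
      using AE_lborel_singleton[of t] that
      by (intro integral_cong_AE) (auto simp: indicator_def elim!: eventually_mono)
    finally show ?thesis by simp
  qed
  have PQ: "integrable (lborel \<Otimes>\<^sub>M lborel) (\<lambda>(t, s). P t * Q s)"
  proof (rule lborel_pair.Fubini_integrable)
    show "integrable lborel (\<lambda>x. \<integral>y. norm (case (x, y) of (t, s) \<Rightarrow> P t * Q s) \<partial>lborel)"
      using P by (simp add: abs_mult)
    show "AE x in lborel. integrable lborel (\<lambda>y. case (x, y) of (t, s) \<Rightarrow> P t * Q s)"
      using Q by simp
  qed measurable
  have H: "integrable (lborel \<Otimes>\<^sub>M lborel) (\<lambda>(t, s). P t * Q s * (if t \<le> s then 1 else 0))"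
    by (rule Bochner_Integration.integrable_bound[OF PQ]) auto
  have "(\<integral>s. (\<integral>t. P t * Q s * (if t \<le> s then 1 else 0) \<partial>lborel) \<partial>lborel)
      = (\<integral>t. (\<integral>s. P t * Q s * (if t \<le> s then 1 else 0) \<partial>lborel) \<partial>lborel)"
    by (rule lborel_pair.Fubini_integral[OF H])
  also have "(\<lambda>s. \<integral>t. P t * Q s * (if t \<le> s then 1 else 0) \<partial>lborel) = (\<lambda>s. Q s * (\<phi> s - \<phi> c))"
  proof
    fix s
    have "(\<integral>t. P t * Q s * (if t \<le> s then 1 else 0) \<partial>lborel) = (\<integral>t. Q s * (indicator {c..s} t * \<phi>' t) \<partial>lborel)"
      by (intro Bochner_Integration.integral_cong refl) (auto simp: P_def Q_def indicator_def)
    also have "\<dots> = Q s * (\<phi> s - \<phi> c)"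
      using ftc[of s] by (cases "s \<in> {c..d}") (auto simp: Q_def)
    finally show "(\<integral>t. P t * Q s * (if t \<le> s then 1 else 0) \<partial>lborel) = Q s * (\<phi> s - \<phi> c)" .
  qed
  also have "(\<lambda>t. \<integral>s. P t * Q s * (if t \<le> s then 1 else 0) \<partial>lborel) = (\<lambda>t. P t * (F d - F t))"
  proof
    fix t
    have "(\<integral>s. P t * Q s * (if t \<le> s then 1 else 0) \<partial>lborel) = (\<integral>s. P t * (indicator {t..d} s * G s) \<partial>lborel)"
      by (intro Bochner_Integration.integral_cong refl) (auto simp: P_def Q_def indicator_def)
    also have "\<dots> = P t * (F d - F t)"
      using dF[of t] by (cases "t \<in> {c..d}") (auto simp: P_def)
    finally show "(\<integral>s. P t * Q s * (if t \<le> s then 1 else 0) \<partial>lborel) = P t * (F d - F t)" .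
  qed
  finally have eq: "(\<integral>s. Q s * (\<phi> s - \<phi> c) \<partial>lborel) = (\<integral>t. P t * (F d - F t) \<partial>lborel)" .
  \<comment> \<open>The full integrals of Q and P evaluate the boundary products that appear when
    both sides of \<open>eq\<close> are expanded.\<close>
  have iQ: "(\<integral>s. Q s \<partial>lborel) = F d - F c" and iP: "(\<integral>t. P t \<partial>lborel) = \<phi> d - \<phi> c"
    using dF[OF le] ftc[of d] le by (simp_all add: Q_def P_def)
  have j1: "integrable lborel (\<lambda>t. indicator {c..d} t * (\<phi>' t * F t))"
    and j2: "integrable lborel (\<lambda>t. indicator {c..d} t * (\<phi> t * G t))"
    by (intro integrable_indicator_mult i1 i2; simp)+
  have "(\<integral>s. Q s * (\<phi> s - \<phi> c) \<partial>lborel)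
      = (\<integral>s. indicator {c..d} s * (\<phi> s * G s) - \<phi> c * Q s \<partial>lborel)"
    by (intro Bochner_Integration.integral_cong refl) (simp add: Q_def algebra_simps)
  also have "\<dots> = (\<integral>s. indicator {c..d} s * (\<phi> s * G s) \<partial>lborel) - \<phi> c * (F d - F c)"
    using j2 Q iQ by simp
  finally have 1: "(\<integral>s. Q s * (\<phi> s - \<phi> c) \<partial>lborel) = \<dots>" .
  have "(\<integral>t. P t * (F d - F t) \<partial>lborel)
      = (\<integral>t. F d * P t - indicator {c..d} t * (\<phi>' t * F t) \<partial>lborel)"
    by (intro Bochner_Integration.integral_cong refl) (simp add: P_def algebra_simps)
  also have "\<dots> = F d * (\<phi> d - \<phi> c) - (\<integral>t. indicator {c..d} t * (\<phi>' t * F t) \<partial>lborel)"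
    using j1 P iP by simp
  finally have 2: "(\<integral>t. P t * (F d - F t) \<partial>lborel) = \<dots>" .
  have "(\<integral>t. indicator {c..d} t * (\<phi>' t * F t + \<phi> t * G t) \<partial>lborel)
     = (\<integral>t. indicator {c..d} t * (\<phi>' t * F t) \<partial>lborel) + (\<integral>t. indicator {c..d} t * (\<phi> t * G t) \<partial>lborel)"
    using j1 j2 by (simp add: distrib_left)
  then show ?thesis using 1 2 eq by (simp add: algebra_simps)
qed

section \<open>Boundary terms at the ends of an open interval\<close>

text \<open>Otherwise |\<Phi>| / e would dominate the indicator of a half-line, which has infinite
  measure.\<close>

lemma exists_small_value_right:
  fixes \<Phi> :: "real \<Rightarrow> real"
  assumes \<Phi>: "integrable lborel \<Phi>" and e: "e > 0"
  shows "\<exists>d\<ge>p. \<bar>\<Phi> d\<bar> < e"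
proof (rule ccontr)
  assume "\<not> (\<exists>d\<ge>p. \<bar>\<Phi> d\<bar> < e)"
  then have big: "e \<le> \<bar>\<Phi> d\<bar>" if "p \<le> d" for d using that by force
  have "integrable lborel (\<lambda>x. (1/e) * \<bar>\<Phi> x\<bar>)" using \<Phi> by simp
  then have "integrable lborel (indicator {p..} :: real \<Rightarrow> real)"
    by (rule Bochner_Integration.integrable_bound) (use big e in \<open>auto simp: indicator_def field_simps\<close>)
  then have fin: "emeasure lborel {p..} < \<infinity>"
    by (simp add: integrable_indicator_iff)
  obtain n :: nat where "emeasure lborel {p..} < of_nat n"
    using fin ennreal_Ex_less_of_nat by (auto simp: less_top)
  moreover have "emeasure lborel {p..p + real n} \<le> emeasure lborel {p..}"
    by (intro emeasure_mono) auto
  ultimately show False by (simp add: ennreal_of_nat_eq_real_of_nat)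
qed

text \<open>Supplies points at which a boundary term becomes negligible. A finite right end lies in
  the closure of C but not in C, so \<Phi> vanishes there and continuity suffices. At an infinite
  end integrability gives small values arbitrarily far out, although \<Phi> need not
  converge.\<close>

lemma right_end_sequence:
  fixes \<Phi> :: "real \<Rightarrow> real"
  assumes C: "open C" "connected C" "p \<in> C"
    and \<Phi>: "continuous_on UNIV \<Phi>" "integrable lborel \<Phi>"
    and zero: "\<And>x. x \<in> closure C - C \<Longrightarrow> \<Phi> x = 0"
  obtains d :: "nat \<Rightarrow> real" where "\<And>k. d k \<in> C" "\<And>k. p \<le> d k"
    "\<And>x. x \<in> C \<Longrightarrow> \<forall>\<^sub>F k in sequentially. x \<le> d k" "(\<lambda>k. \<Phi> (d k)) \<longlonglongrightarrow> 0"
proof (cases "bdd_above C")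
  case True
  define b where "b = Sup C"
  have bub: "x \<le> b" if "x \<in> C" for x using that True by (simp add: b_def cSup_upper)
  have "b \<in> closure C" unfolding b_def using C(3) True by (intro closure_contains_Sup) auto
  moreover have "b \<notin> C"
  proof
    assume "b \<in> C"
    then obtain e where "e > 0" "ball b e \<subseteq> C" using C(1) openE by blast
    then have "b + e / 2 \<in> C" by (auto simp: dist_real_def subset_iff)
    with bub[of "b + e / 2"] \<open>e > 0\<close> show False by simp
  qed
  ultimately have \<Phi>b: "\<Phi> b = 0" using zero by simp
  have pb: "p < b" using bub[OF C(3)] C(3) \<open>b \<notin> C\<close> by (metis order_le_less)
  \<comment> \<open>These points start at p and increase to b; connectedness keeps them in
    C.\<close>
  define d where "d k = b - (b - p) * (1 / real (Suc k))" for k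
  have pd: "p \<le> d k" for k
    using pb mult_left_le[of "1 / real (Suc k)" "b - p"] by (simp add: d_def)
  have db: "d k < b" for k using pb by (simp add: d_def)
  have dC: "d k \<in> C" for k
  proof -
    obtain y where y: "y \<in> C" "d k < y"
      using less_cSup_iff[of C "d k"] True C(3) db by (auto simp: b_def)
    then show ?thesis
      using connected_contains_Icc[OF C(2,3), of y] pd[of k] by (auto simp: subset_iff)
  qed
  have "d \<longlonglongrightarrow> b - (b - p) * 0"
    unfolding d_def by (intro tendsto_intros LIMSEQ_Suc[OF lim_1_over_n])
  then have db2: "d \<longlonglongrightarrow> b" by simp
  show ?thesis
  proof (rule that[of d])
    show "\<forall>\<^sub>F k in sequentially. x \<le> d k" if "x \<in> C" for x
    proof -
      have "x < b" using bub[OF that] that \<open>b \<notin> C\<close> by (metis order_le_less)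
      from order_tendstoD(1)[OF db2 this] show ?thesis by (auto elim: eventually_mono)
    qed
    have "isCont \<Phi> b" using \<Phi>(1) by (simp add: continuous_on_eq_continuous_at)
    from isCont_tendsto_compose[OF this db2] show "(\<lambda>k. \<Phi> (d k)) \<longlonglongrightarrow> 0" by (simp add: \<Phi>b)
  qed (use dC pd in auto)
next
  case False
  have "\<exists>d\<ge>max p (real k). \<bar>\<Phi> d\<bar> < 1 / real (Suc k)" for k
    by (rule exists_small_value_right[OF \<Phi>(2)]) simp
  then obtain d where d: "\<And>k. max p (real k) \<le> d k" "\<And>k. \<bar>\<Phi> (d k)\<bar> < 1 / real (Suc k)" by metis
  show ?thesis
  proof (rule that[of d])
    show "d k \<in> C" for k
    proof -
      obtain y where y: "y \<in> C" "d k < y"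
        using False by (auto simp: bdd_above_def not_le)
      then show ?thesis
        using connected_contains_Icc[OF C(2,3), of y] d(1)[of k] by (auto simp: subset_iff)
    qed
    show "p \<le> d k" for k using d(1)[of k] by simp
    show "\<forall>\<^sub>F k in sequentially. x \<le> d k" for x
      using eventually_ge_at_top[of "nat \<lceil>x\<rceil>"]
    proof eventually_elim
      case (elim k)
      then show ?case using d(1)[of k] by linarith
    qed
    show "(\<lambda>k. \<Phi> (d k)) \<longlonglongrightarrow> 0"
      by (rule Lim_null_comparison[OF _ LIMSEQ_Suc[OF lim_1_over_n]])
         (use d(2) in \<open>auto simp: less_imp_le\<close>)
  qed
qed

text \<open>Reflection x -> -x reduces this to the right end.\<close>

lemma left_end_sequence:
  fixes \<Phi> :: "real \<Rightarrow> real"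
  assumes C: "open C" "connected C" "p \<in> C"
    and \<Phi>: "continuous_on UNIV \<Phi>" "integrable lborel \<Phi>"
    and zero: "\<And>x. x \<in> closure C - C \<Longrightarrow> \<Phi> x = 0"
  obtains c :: "nat \<Rightarrow> real" where "\<And>k. c k \<in> C" "\<And>k. c k \<le> p"
    "\<And>x. x \<in> C \<Longrightarrow> \<forall>\<^sub>F k in sequentially. c k \<le> x" "(\<lambda>k. \<Phi> (c k)) \<longlonglongrightarrow> 0"
proof -
  have cl: "closure (uminus ` C) = uminus ` closure C"
    using closure_scaleR[of "-1" C] by simp
  have "open (uminus ` C)" using C(1) by (rule open_negations)
  moreover have "connected (uminus ` C)" using C(2) by (intro connected_continuous_image continuous_intros)
  moreover have "- p \<in> uminus ` C" using C(3) by simp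
  moreover have "continuous_on UNIV (\<lambda>x. \<Phi> (- x))"
    by (rule continuous_on_compose2[OF \<Phi>(1)]) (auto intro: continuous_intros)
  moreover have "integrable lborel (\<lambda>x. \<Phi> (- x))"
    using lborel_integrable_real_affine[OF \<Phi>(2), of "-1" 0] by simp
  moreover have "\<Phi> (- x) = 0" if "x \<in> closure (uminus ` C) - uminus ` C" for x
    using that zero[of "- x"] unfolding cl by (metis DiffD1 DiffD2 DiffI add.inverse_inverse image_iff)
  ultimately obtain d :: "nat \<Rightarrow> real" where d: "\<And>k. d k \<in> uminus ` C" "\<And>k. - p \<le> d k"
    "\<And>x. x \<in> uminus ` C \<Longrightarrow> \<forall>\<^sub>F k in sequentially. x \<le> d k" "(\<lambda>k. \<Phi> (- d k)) \<longlonglongrightarrow> 0"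
    using right_end_sequence[of "uminus ` C" "- p" "\<lambda>x. \<Phi> (- x)"] by metis
  show ?thesis
  proof (rule that[of "\<lambda>k. - d k"])
    show "- d k \<in> C" for k using d(1)[of k] by auto
    show "- d k \<le> p" for k using d(2)[of k] by simp
    show "\<forall>\<^sub>F k in sequentially. - d k \<le> x" if "x \<in> C" for x
      using d(3)[of "- x"] that by (auto elim: eventually_mono)
  qed (rule d(4))
qed

text \<open>Every point of C eventually lies in [c_k, d_k], so with |\<psi>| as dominating function
  the integrals over these intervals converge to the one over C, while their boundary terms tend to
  0.\<close>

lemma integral_component_eq_0:
  fixes \<Phi> \<psi> :: "real \<Rightarrow> real"
  assumes C: "open C" "connected C" "p \<in> C"
    and \<Phi>: "continuous_on UNIV \<Phi>" "integrable lborel \<Phi>"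
    and zero: "\<And>x. x \<in> closure C - C \<Longrightarrow> \<Phi> x = 0"
    and \<psi>: "integrable lborel \<psi>"
    and ftc: "\<And>c d. c \<le> d \<Longrightarrow> {c..d} \<subseteq> C \<Longrightarrow> (\<integral>t. indicator {c..d} t * \<psi> t \<partial>lborel) = \<Phi> d - \<Phi> c"
  shows "(\<integral>t. indicator C t * \<psi> t \<partial>lborel) = 0"
proof -
  have [measurable]: "\<psi> \<in> borel_measurable borel" using \<psi> by auto
  have [measurable]: "C \<in> sets borel" using C(1) by simp
  obtain d :: "nat \<Rightarrow> real" where d: "\<And>k. d k \<in> C" "\<And>k. p \<le> d k"
    "\<And>x. x \<in> C \<Longrightarrow> \<forall>\<^sub>F k in sequentially. x \<le> d k" "(\<lambda>k. \<Phi> (d k)) \<longlonglongrightarrow> 0"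
    using right_end_sequence[OF C \<Phi> zero] by metis
  obtain c :: "nat \<Rightarrow> real" where c: "\<And>k. c k \<in> C" "\<And>k. c k \<le> p"
    "\<And>x. x \<in> C \<Longrightarrow> \<forall>\<^sub>F k in sequentially. c k \<le> x" "(\<lambda>k. \<Phi> (c k)) \<longlonglongrightarrow> 0"
    using left_end_sequence[OF C \<Phi> zero] by metis
  have sub: "{c k..d k} \<subseteq> C" for k
    by (rule connected_contains_Icc[OF C(2) c(1) d(1)])
  have "(\<lambda>k. \<integral>t. indicator {c k..d k} t * \<psi> t \<partial>lborel) \<longlonglongrightarrow> (\<integral>t. indicator C t * \<psi> t \<partial>lborel)"
  proof (rule integral_dominated_convergence[where w="\<lambda>t. \<bar>\<psi> t\<bar>"])
    show "AE t in lborel. (\<lambda>k. indicator {c k..d k} t * \<psi> t) \<longlonglongrightarrow> indicator C t * \<psi> t"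
    proof (rule AE_I2)
      fix t :: real
      have "\<forall>\<^sub>F k in sequentially. indicator {c k..d k} t = (indicator C t :: real)"
      proof (cases "t \<in> C")
        case True
        from c(3)[OF True] d(3)[OF True] show ?thesis
          by eventually_elim (simp add: True)
      next
        case False
        then have "t \<notin> {c k..d k}" for k using sub[of k] by blast
        then show ?thesis using False by (simp add: indicator_def)
      qed
      then have "(\<lambda>k. indicator {c k..d k} t :: real) \<longlonglongrightarrow> indicator C t"
        by (rule tendsto_eventually)
      then show "(\<lambda>k. indicator {c k..d k} t * \<psi> t) \<longlonglongrightarrow> indicator C t * \<psi> t"
        by (intro tendsto_intros)
    qed
  qed (use \<psi> in \<open>auto simp: abs_mult indicator_def\<close>)
  moreover have "(\<integral>t. indicator {c k..d k} t * \<psi> t \<partial>lborel) = \<Phi> (d k) - \<Phi> (c k)" for k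
    using ftc[OF _ sub[of k]] c(2)[of k] d(2)[of k] by simp
  moreover have "(\<lambda>k. \<Phi> (d k) - \<Phi> (c k)) \<longlonglongrightarrow> 0 - 0"
    using c(4) d(4) by (intro tendsto_intros)
  ultimately show ?thesis using LIMSEQ_unique by fastforce
qed

text \<open>\<open>F\<close> need not have a positive lower bound, and \<open>\<phi>'\<close> need not be locally integrable where
  \<open>F\<close> vanishes; the integral is therefore computed on each component of \<open>{F > 0}\<close>, where \<open>\<phi> F\<close>
  vanishes at both ends.\<close>

lemma integral_by_parts_line:
  fixes F G \<phi> \<phi>' :: "real \<Rightarrow> real"
  assumes G: "integrable lborel G"
    and F: "\<And>t. F t = C + (\<integral>s. indicator {..t} s * G s \<partial>lborel)"
    and F0: "\<And>t. 0 \<le> F t"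
    and G0: "AE t in lborel. F t = 0 \<longrightarrow> G t = 0"
    and \<phi>: "\<And>t. (\<phi> has_real_derivative \<phi>' t) (at t)"
    and i1: "integrable lborel (\<lambda>t. \<phi>' t * F t)"
    and i2: "integrable lborel (\<lambda>t. \<phi> t * G t)"
    and i3: "integrable lborel (\<lambda>t. \<phi> t * F t)"
  shows "(\<integral>t. \<phi>' t * F t + \<phi> t * G t \<partial>lborel) = 0"
proof -
  define \<psi> where "\<psi> t = \<phi>' t * F t + \<phi> t * G t" for t
  define U where "U = {t. F t > 0}"
  have \<psi>: "integrable lborel \<psi>" unfolding \<psi>_def using i1 i2 by auto
  then have [measurable]: "\<psi> \<in> borel_measurable borel" by auto
  have contF: "continuous_on UNIV F"
    unfolding F by (intro continuous_intros continuous_indefinite_lborel_integral G)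
  have cont\<phi>: "continuous_on UNIV \<phi>"
    by (intro continuous_at_imp_continuous_on ballI DERIV_isCont[OF \<phi>])
  have U: "open U" unfolding U_def using contF by (intro open_Collect_less continuous_intros)
  have comp: "(\<integral>t. indicator K t * \<psi> t \<partial>lborel) = 0" if K: "K \<in> components U" for K
  proof -
    obtain p where "p \<in> K" using in_components_nonempty[OF K] by blast
    have KU: "K \<subseteq> U" by (rule in_components_subset[OF K])
    show ?thesis
    proof (rule integral_component_eq_0[of K p "\<lambda>t. \<phi> t * F t"])
      show "open K" using open_components[OF U K] .
      show "connected K" by (rule in_components_connected[OF K])
      show "continuous_on UNIV (\<lambda>t. \<phi> t * F t)" using contF cont\<phi> by (intro continuous_intros)
      show "(\<integral>t. indicator {c..d} t * \<psi> t \<partial>lborel) = \<phi> d * F d - \<phi> c * F c"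
        if "c \<le> d" "{c..d} \<subseteq> K" for c d
        unfolding \<psi>_def using that KU
        by (intro integral_by_parts_pos[OF G F \<phi> i1 i2]) (auto simp: U_def)
      fix x assume x: "x \<in> closure K - K"
      \<comment> \<open>Otherwise K enlarged by x would be a connected subset of U, against the
        maximality of the component K.\<close>
      have "x \<notin> U"
      proof
        assume "x \<in> U"
        have "connected (insert x K)"
          using connected_intermediate_closure[OF in_components_connected[OF K], of "insert x K"] x closure_subset[of K] by auto
        then have "insert x K \<subseteq> K"
          using \<open>x \<in> U\<close> KU \<open>p \<in> K\<close> by (intro components_maximal[OF K]) auto
        then show False using x by blast
      qed
      then have "F x = 0" using F0[of x] by (auto simp: U_def)
      then show "\<phi> x * F x = 0" by simp
    qed (use i3 \<psi> \<open>p \<in> K\<close> in auto)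
  qed
  have cnt: "countable (components U)" 
    using open_components[OF U] pairwise_disjoint_components
    by (intro countable_disjoint_open_subsets) (auto simp: disjnt_def[abs_def])
  define A where "A i = (if i \<in> to_nat_on (components U) ` components U
      then from_nat_into (components U) i else {})" for i
  have Acomp: "A i = {} \<or> A i \<in> components U" for i
    using cnt by (auto simp: A_def)
  have UA: "(\<Union>i. A i) = U"
  proof
    show "(\<Union>i. A i) \<subseteq> U" using Acomp in_components_subset by fastforce
    show "U \<subseteq> (\<Union>i. A i)"
    proof
      fix x assume "x \<in> U"
      then obtain K where K: "K \<in> components U" "x \<in> K" using Union_components[of U] by blast
      then have "A (to_nat_on (components U) K) = K" using cnt by (simp add: A_def)
      with K show "x \<in> (\<Union>i. A i)" by blast
    qed
  qed
  have "(LINT t:(\<Union>i. A i)|lborel. \<psi> t) = (\<Sum>i. (LINT t:A i|lborel. \<psi> t))"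
  proof (rule lebesgue_integral_countable_add)
    show "A i \<in> sets lborel" for i using Acomp[of i] open_components[OF U] by auto
    show "A i \<inter> A j = {}" if "i \<noteq> j" for i j
    proof (cases "A i = {} \<or> A j = {}")
      case False
      then have ij: "i \<in> to_nat_on (components U) ` components U" "j \<in> to_nat_on (components U) ` components U"
        by (auto simp: A_def split: if_splits)
      then have "A i \<noteq> A j" using that cnt by (auto simp: A_def)
      moreover have "A i \<in> components U" "A j \<in> components U" using False Acomp by blast+
      ultimately show ?thesis using components_nonoverlap by blast
    qed auto
    show "set_integrable lborel (\<Union>i. A i) \<psi>"
      unfolding UA set_integrable_def using U \<psi> by (intro integrable_mult_indicator) auto
  qed
  moreover have "(LINT t:A i|lborel. \<psi> t) = 0" for i
    using Acomp[of i] comp by (auto simp: set_lebesgue_integral_def)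
  ultimately have "(\<integral>t. indicator U t * \<psi> t \<partial>lborel) = 0"
    by (simp add: UA set_lebesgue_integral_def)
  \<comment> \<open>Off U one has F = 0, hence G = 0 almost everywhere, so the integrand vanishes
    there.\<close>
  moreover have "(\<integral>t. \<psi> t \<partial>lborel) = (\<integral>t. indicator U t * \<psi> t \<partial>lborel)"
  proof (rule integral_cong_AE)
    show "AE t in lborel. \<psi> t = indicator U t * \<psi> t"
      using G0
    proof eventually_elim
      case (elim t)
      then show ?case using F0[of t] by (cases "t \<in> U") (auto simp: U_def \<psi>_def)
    qed
    have [measurable]: "U \<in> sets borel" using U by simp
    show "\<psi> \<in> borel_measurable lborel" "(\<lambda>t. indicator U t * \<psi> t) \<in> borel_measurable lborel"
      using \<psi> by measurable
  qed
  ultimately show ?thesis by (simp add: \<psi>_def)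
qed

section \<open>Integration by parts against a density with a score\<close>

lemma
  fixes f :: "'b::euclidean_space \<Rightarrow> 'c::{banach, second_countable_topology}"
  assumes [measurable]: "f \<in> borel_measurable borel"
  shows lborel_integrable_translate: "integrable lborel (\<lambda>x. f (x + v)) \<longleftrightarrow> integrable lborel f"
    and lborel_integral_translate: "(\<integral>x. f (x + v) \<partial>lborel) = (\<integral>x. f x \<partial>lborel)"
  using integrable_distr_eq[of "(+) v" lborel borel f] integral_distr[of "(+) v" lborel borel f]
  by (simp_all add: lborel_distr_plus add.commute[of v])

lemma has_real_derivative_along_axis:
  fixes \<phi> :: "real^'d::finite \<Rightarrow> real"
  assumes "\<phi> differentiable (at (y + t *\<^sub>R axis j 1))"
  shows "((\<lambda>t. \<phi> (y + t *\<^sub>R axis j 1)) has_real_derivative partial_deriv j \<phi> (y + t *\<^sub>R axis j 1)) (at t)"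
proof -
  have "((\<lambda>t. y + t *\<^sub>R axis j 1) has_derivative (\<lambda>h. h *\<^sub>R axis j 1)) (at t)"
    by (auto intro!: derivative_eq_intros)
  from has_derivative_compose[OF this differentiable_has_frechet_derivative[OF assms]]
  moreover have "(\<lambda>h. frechet_derivative \<phi> (at (y + t *\<^sub>R axis j 1)) (h *\<^sub>R axis j 1))
      = (*) (partial_deriv j \<phi> (y + t *\<^sub>R axis j 1))"
    using linear_scale[OF linear_frechet_derivative[OF assms]]
    by (intro ext) (simp add: partial_deriv_def mult.commute)
  ultimately show ?thesis
    by (simp add: has_field_derivative_def o_def)
qed

lemma partial_deriv_borel_measurable:
  fixes \<phi> :: "real^'d::finite \<Rightarrow> real"
  assumes "\<And>x. \<phi> differentiable (at x)"
  shows "\<phi> \<in> borel_measurable borel" "partial_deriv j \<phi> \<in> borel_measurable borel"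
proof -
  have "continuous_on UNIV \<phi>"
    using assms by (intro continuous_at_imp_continuous_on ballI differentiable_imp_continuous_within)
  then show [measurable]: "\<phi> \<in> borel_measurable borel"
    by (rule borel_measurable_continuous_onI)
  show "partial_deriv j \<phi> \<in> borel_measurable borel"
  proof (rule borel_measurable_LIMSEQ_real)
    fix x :: "real^'d"
    have "((\<lambda>h. (\<phi> (x + h *\<^sub>R axis j 1) - \<phi> x) / h) \<longlongrightarrow> partial_deriv j \<phi> x) (at 0)"
      using has_real_derivative_along_axis[of \<phi> x 0 j] assms by (simp add: DERIV_def)
    moreover have "filterlim (\<lambda>n. 1 / real (Suc n)) (at 0) sequentially"
      by (auto simp: filterlim_at intro!: LIMSEQ_Suc[OF lim_1_over_n] simp del: of_nat_Suc)
    ultimately show "(\<lambda>n. (\<phi> (x + (1 / real (Suc n)) *\<^sub>R axis j 1) - \<phi> x) / (1 / real (Suc n)))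
        \<longlonglongrightarrow> partial_deriv j \<phi> x"
      by (rule filterlim_compose)
  qed measurable
qed

text \<open>The fundamental theorem along the segment from x to x - h e_j. Parametrizing by the unit
  interval treats both signs of h at once.\<close>

lemma test_function_increment:
  fixes u :: "real^'d::finite \<Rightarrow> real"
  assumes u: "test_function u"
  shows "(\<integral>s. indicator {0..1} s * (h * partial_deriv j u (x - (s * h) *\<^sub>R axis j 1)) \<partial>lborel)
    = u x - u (x - h *\<^sub>R axis j 1)"
proof -
  have cont: "continuous_on UNIV (partial_deriv j u)"
    using test_function_bounds[OF u] by metis
  have "((\<lambda>s. - u (x - (s * h) *\<^sub>R axis j 1)) has_real_derivative
      h * partial_deriv j u (x - (s * h) *\<^sub>R axis j 1)) (at s)" for s
  proof -
    have "((\<lambda>s. - (s * h)) has_real_derivative - h) (at s)"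
      by (auto intro!: derivative_eq_intros)
    from DERIV_chain2[OF has_real_derivative_along_axis[where y=x and t="- (s * h)" and j=j,
        OF test_function_differentiable[OF u]] this]
    have "((\<lambda>s. u (x - (s * h) *\<^sub>R axis j 1)) has_real_derivative
      - (h * partial_deriv j u (x - (s * h) *\<^sub>R axis j 1))) (at s)"
      by (simp add: mult.commute)
    from DERIV_minus[OF this] show ?thesis by simp
  qed
  then have "(\<integral>s. indicator {0..1} s *\<^sub>R (h * partial_deriv j u (x - (s * h) *\<^sub>R axis j 1)) \<partial>lborel)
    = - u (x - (1 * h) *\<^sub>R axis j 1) - - u (x - (0 * h) *\<^sub>R axis j 1)"
    by (intro integral_FTC_Icc)
       (auto simp: has_real_derivative_iff_has_vector_derivative intro: has_vector_derivative_at_within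
         intro!: continuous_intros continuous_on_compose2[OF cont])
  then show ?thesis by simp
qed

text \<open>By translation invariance all slices in s have the same L1 norm, so Fubini applies over
  the unit interval, and a bounded weight does no harm. With h = 0 the lemma also covers the
  situation where the translation sits in the weight.\<close>

lemma integrable_segment_pair:
  fixes g :: "real^'d::finite \<Rightarrow> real"
  assumes g: "integrable lborel g" and b: "b \<in> borel_measurable borel" "\<And>s x. \<bar>b (s, x)\<bar> \<le> B"
  shows "integrable (lborel \<Otimes>\<^sub>M lborel)
    (\<lambda>(s, x). indicator {0..1} s * (b (s, x) * g (x + (s * h) *\<^sub>R e)))"
proof -
  have [measurable]: "g \<in> borel_measurable borel" "b \<in> borel_measurable (lborel \<Otimes>\<^sub>M lborel)"
    using g b by (auto simp: lborel_prod)
  have "integrable (lborel \<Otimes>\<^sub>M lborel) (\<lambda>(s, x). indicator {0..1} s * (B * g (x + (s * h) *\<^sub>R e)))"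
  proof (rule lborel_pair.Fubini_integrable)
    have "(\<integral>x. \<bar>g (x + v)\<bar> \<partial>lborel) = (\<integral>x. \<bar>g x\<bar> \<partial>lborel)" for v
      by (rule lborel_integral_translate[of "\<lambda>x. \<bar>g x\<bar>"]) measurable
    then show "integrable lborel (\<lambda>s. \<integral>x. norm (case (s, x) of (s, x) \<Rightarrow> indicator {0..1} s * (B * g (x + (s * h) *\<^sub>R e))) \<partial>lborel)"
      by (simp add: abs_mult)
    show "AE s in lborel. integrable lborel (\<lambda>x. case (s, x) of (s, x) \<Rightarrow> indicator {0..1} s * (B * g (x + (s * h) *\<^sub>R e)))"
      using g by (simp add: lborel_integrable_translate)
  qed measurable
  then show ?thesis
  proof (rule Bochner_Integration.integrable_bound)
    have "\<bar>b (s, x)\<bar> \<le> \<bar>B\<bar>" for s x using b(2)[of s x] by linarith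
    then show "AE p in lborel \<Otimes>\<^sub>M lborel. norm (case p of (s, x) \<Rightarrow> indicator {0..1} s * (b (s, x) * g (x + (s * h) *\<^sub>R e)))
        \<le> norm (case p of (s, x) \<Rightarrow> indicator {0..1} s * (B * g (x + (s * h) *\<^sub>R e)))"
      by (intro AE_I2) (auto simp: abs_mult intro!: mult_left_mono mult_right_mono)
  qed measurable
qed

text \<open>A density with an integrable weak derivative is absolutely continuous along almost every
  line in that direction.\<close>

lemma weak_derivative_increment:
  fixes f g :: "real^'d::finite \<Rightarrow> real"
  assumes f: "integrable lborel f" and g: "integrable lborel g"
    and weak: "\<And>u. test_function u \<Longrightarrow>
      (\<integral>x. u x * g x \<partial>lborel) = - (\<integral>x. partial_deriv j u x * f x \<partial>lborel)"
  shows "AE x in lborel. f (x + h *\<^sub>R axis j 1) - f x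
    = (\<integral>s. indicator {0..1} s * (h * g (x + (s * h) *\<^sub>R axis j 1)) \<partial>lborel)"
proof -
  let ?e = "axis j 1 :: real^'d"
  define R where "R x = (\<integral>s. indicator {0..1} s * (h * g (x + (s * h) *\<^sub>R ?e)) \<partial>lborel)" for x
  have [measurable]: "f \<in> borel_measurable borel" "g \<in> borel_measurable borel"
    using f g by auto
  have R: "integrable lborel R"
    using lborel_pair.integrable_snd[OF integrable_segment_pair[OF g, of "\<lambda>_. h" "\<bar>h\<bar>" h ?e]]
    by (simp add: R_def[abs_def])
  have ft: "integrable lborel (\<lambda>x. f (x + v))" for v
    using f by (simp add: lborel_integrable_translate)
  have "AE x in lborel. f (x + h *\<^sub>R ?e) - f x - R x = 0"
  proof (rule AE_0_if_integral_test_function_0)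
    show "integrable lborel (\<lambda>x. f (x + h *\<^sub>R ?e) - f x - R x)"
      using ft f R by (intro Bochner_Integration.integrable_diff)
    fix u :: "real^'d \<Rightarrow> real" assume u: "test_function u"
    obtain B where B: "continuous_on UNIV u" "continuous_on UNIV (partial_deriv j u)"
      "\<And>x. \<bar>u x\<bar> \<le> B" "\<And>x. \<bar>partial_deriv j u x\<bar> \<le> B"
      using test_function_bounds[OF u] by metis
    have [measurable]: "u \<in> borel_measurable borel" "partial_deriv j u \<in> borel_measurable borel"
      using B by (auto intro: borel_measurable_continuous_onI)
    note um = integrable_test_function_mult[OF _ u, of lborel]
    \<comment> \<open>For fixed s the translation is moved onto u, whose translate is again a test
      function, so the weak identity applies to it.\<close>
    have *: "(\<integral>x. u x * g (x + (s * h) *\<^sub>R ?e) \<partial>lborel)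
        = - (\<integral>x. partial_deriv j u (x - (s * h) *\<^sub>R ?e) * f x \<partial>lborel)" for s
    proof -
      have "(\<integral>x. u x * g (x + (s * h) *\<^sub>R ?e) \<partial>lborel) = (\<integral>x. u (x - (s * h) *\<^sub>R ?e) * g x \<partial>lborel)"
        using lborel_integral_translate[of "\<lambda>x. u (x - (s * h) *\<^sub>R ?e) * g x" "(s * h) *\<^sub>R ?e"] by simp
      also have "\<dots> = - (\<integral>x. partial_deriv j (\<lambda>x. u (x - (s * h) *\<^sub>R ?e)) x * f x \<partial>lborel)"
        using test_function_affine[OF u, of 1 "- (s * h) *\<^sub>R ?e"] by (intro weak) simp
      also have "partial_deriv j (\<lambda>x. u (x - (s * h) *\<^sub>R ?e)) = (\<lambda>x. partial_deriv j u (x - (s * h) *\<^sub>R ?e))"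
        using partial_deriv_affine(2)[of u 1 _ "- (s * h) *\<^sub>R ?e" j] test_function_differentiable[OF u]
        by (intro ext) simp
      finally show ?thesis .
    qed
    have i1: "integrable (lborel \<Otimes>\<^sub>M lborel) (\<lambda>(s, x). indicator {0..1} s * ((h * u x) * g (x + (s * h) *\<^sub>R ?e)))"
      using integrable_segment_pair[OF g, of "\<lambda>(s, x). h * u x" "\<bar>h\<bar> * B" h ?e] B
      by (simp add: abs_mult mult_left_mono split_beta borel_prod[symmetric])
    have i2: "integrable (lborel \<Otimes>\<^sub>M lborel) (\<lambda>(s, x). indicator {0..1} s * ((h * partial_deriv j u (x - (s * h) *\<^sub>R ?e)) * f x))"
      using integrable_segment_pair[OF f, of "\<lambda>(s, x). h * partial_deriv j u (x - (s * h) *\<^sub>R ?e)" "\<bar>h\<bar> * B" 0 ?e] B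
      by (simp add: abs_mult mult_left_mono split_beta borel_prod[symmetric])
    \<comment> \<open>Fubini brings s outside so that the weak identity can act for each s, then
      back inside, where the integrated derivative is an increment of u; a translation hands that
      increment over to f.\<close>
    have "(\<integral>x. u x * R x \<partial>lborel) = (\<integral>x. (\<integral>s. indicator {0..1} s * ((h * u x) * g (x + (s * h) *\<^sub>R ?e)) \<partial>lborel) \<partial>lborel)"
      unfolding R_def by (subst integral_mult_right_zero[symmetric]) (simp add: mult_ac)
    also have "\<dots> = (\<integral>s. (\<integral>x. indicator {0..1} s * ((h * u x) * g (x + (s * h) *\<^sub>R ?e)) \<partial>lborel) \<partial>lborel)"
      by (rule lborel_pair.Fubini_integral[OF i1])
    also have "\<dots> = (\<integral>s. indicator {0..1} s * h * (\<integral>x. u x * g (x + (s * h) *\<^sub>R ?e) \<partial>lborel) \<partial>lborel)"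
      by (subst integral_mult_right_zero[symmetric]) (simp add: mult_ac)
    also have "\<dots> = - (\<integral>s. (\<integral>x. indicator {0..1} s * ((h * partial_deriv j u (x - (s * h) *\<^sub>R ?e)) * f x) \<partial>lborel) \<partial>lborel)"
      unfolding * by (simp add: mult.assoc flip: integral_mult_right_zero integral_minus)
    also have "\<dots> = - (\<integral>x. (\<integral>s. indicator {0..1} s * ((h * partial_deriv j u (x - (s * h) *\<^sub>R ?e)) * f x) \<partial>lborel) \<partial>lborel)"
      by (subst lborel_pair.Fubini_integral[OF i2]) simp
    also have "\<dots> = - (\<integral>x. (u x - u (x - h *\<^sub>R ?e)) * f x \<partial>lborel)"
      unfolding test_function_increment[OF u, symmetric]
      by (simp add: mult.assoc flip: integral_mult_left_zero)
    also have "\<dots> = (\<integral>x. u (x - h *\<^sub>R ?e) * f x - u x * f x \<partial>lborel)"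
      by (simp add: algebra_simps flip: integral_minus)
    also have "\<dots> = (\<integral>x. u (x - h *\<^sub>R ?e) * f x \<partial>lborel) - (\<integral>x. u x * f x \<partial>lborel)"
    proof (rule Bochner_Integration.integral_diff)
      show "integrable lborel (\<lambda>x. u (x - h *\<^sub>R ?e) * f x)"
        using integrable_test_function_mult(1)[OF f test_function_affine[OF u, of 1 "- h *\<^sub>R ?e"]] by simp
    qed (use um f in auto)
    also have "(\<integral>x. u (x - h *\<^sub>R ?e) * f x \<partial>lborel) = (\<integral>x. u x * f (x + h *\<^sub>R ?e) \<partial>lborel)"
      using lborel_integral_translate[of "\<lambda>x. u (x - h *\<^sub>R ?e) * f x" "h *\<^sub>R ?e"] by simp
    finally show "(\<integral>x. u x * (f (x + h *\<^sub>R ?e) - f x - R x) \<partial>lborel) = 0"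
      using um(1)[OF ft] um(1)[OF f] um(1)[OF R] by (simp add: right_diff_distrib)
  qed
  then show ?thesis by (auto simp: R_def elim!: eventually_mono)
qed

text \<open>Averaging over the position of the slab reduces integrals over the space to integrals over
  lines, without splitting off a coordinate from the index type.\<close>

lemma
  fixes \<Psi> :: "real^'d::finite \<Rightarrow> real" and j :: 'd
  defines "S \<equiv> {y :: real^'d. 0 \<le> y $ j \<and> y $ j \<le> 1}"
  assumes \<Psi>: "integrable lborel \<Psi>"
  shows integrable_slab_lines: "AE y in lborel. y \<in> S \<longrightarrow> integrable lborel (\<lambda>t. \<Psi> (y + t *\<^sub>R axis j 1))"
    and integral_slab_lines:
      "(\<integral>x. \<Psi> x \<partial>lborel) = (\<integral>y. indicator S y * (\<integral>t. \<Psi> (y + t *\<^sub>R axis j 1) \<partial>lborel) \<partial>lborel)"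
proof -
  let ?e = "axis j 1 :: real^'d"
  have [measurable]: "\<Psi> \<in> borel_measurable borel" using \<Psi> by auto
  have [measurable]: "S \<in> sets borel" unfolding S_def by measurable
  define T where "T t x = indicator S (x - t *\<^sub>R ?e) * \<Psi> x" for t x
  \<comment> \<open>As a function of t this is supported on an interval of length one, so
    integrating out t returns \<Psi>(x).\<close>
  have Te: "T t x = indicator {x $ j - 1..x $ j} t * \<Psi> x" for t x
    by (auto simp: T_def S_def indicator_def)
  have T1: "integrable (lborel \<Otimes>\<^sub>M lborel) (\<lambda>(x, t). T t x)"
  proof (rule lborel_pair.Fubini_integrable)
    show "integrable lborel (\<lambda>x. \<integral>t. norm (case (x, t) of (x, t) \<Rightarrow> T t x) \<partial>lborel)"
      using \<Psi> by (simp add: Te abs_mult)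
    show "AE x in lborel. integrable lborel (\<lambda>t. case (x, t) of (x, t) \<Rightarrow> T t x)"
      by (simp add: Te)
  qed (simp add: T_def)
  have T2: "integrable (lborel \<Otimes>\<^sub>M lborel) (\<lambda>(t, x). T t x)"
    using lborel_pair.integrable_product_swap[OF T1] by simp
  \<comment> \<open>The integrand after substituting y = x - t e_j for fixed t, so that the base
    point y ranges over the slab.\<close>
  define V where "V t y = indicator S y * \<Psi> (y + t *\<^sub>R ?e)" for t y
  have VT: "V t y = T t (y + t *\<^sub>R ?e)" for t y by (simp add: V_def T_def)
  have [measurable]: "T t \<in> borel_measurable borel" for t unfolding T_def by measurable
  have V2: "integrable (lborel \<Otimes>\<^sub>M lborel) (\<lambda>(t, y). V t y)"
  proof (rule lborel_pair.Fubini_integrable)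
    have "(\<integral>y. \<bar>V t y\<bar> \<partial>lborel) = (\<integral>x. \<bar>T t x\<bar> \<partial>lborel)" for t
      unfolding VT by (rule lborel_integral_translate[of "\<lambda>x. \<bar>T t x\<bar>"]) measurable
    then show "integrable lborel (\<lambda>t. \<integral>y. norm (case (t, y) of (t, y) \<Rightarrow> V t y) \<partial>lborel)"
      using lborel_pair.integrable_fst[of "\<lambda>t x. \<bar>T t x\<bar>"] integrable_abs[OF T2]
      by (simp add: split_beta')
    show "AE t in lborel. integrable lborel (\<lambda>y. case (t, y) of (t, y) \<Rightarrow> V t y)"
      using \<Psi> by (auto simp: V_def lborel_integrable_translate intro!: integrable_indicator_mult)
  qed (simp add: V_def)
  have V1: "integrable (lborel \<Otimes>\<^sub>M lborel) (\<lambda>(y, t). V t y)"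
    using lborel_pair.integrable_product_swap[OF V2] by simp
  have "AE y in lborel. integrable lborel (\<lambda>t. V t y)"
    using lborel_pair.AE_integrable_fst'[OF V1] by simp
  then show "AE y in lborel. y \<in> S \<longrightarrow> integrable lborel (\<lambda>t. \<Psi> (y + t *\<^sub>R ?e))"
    by eventually_elim (auto simp: V_def)
  have "(\<integral>x. \<Psi> x \<partial>lborel) = (\<integral>x. (\<integral>t. T t x \<partial>lborel) \<partial>lborel)"
    by (simp add: Te)
  also have "\<dots> = (\<integral>t. (\<integral>x. T t x \<partial>lborel) \<partial>lborel)"
    by (rule lborel_pair.Fubini_integral[OF T2])
  also have "\<dots> = (\<integral>t. (\<integral>y. V t y \<partial>lborel) \<partial>lborel)"
    unfolding VT by (simp add: lborel_integral_translate)
  also have "\<dots> = (\<integral>y. (\<integral>t. V t y \<partial>lborel) \<partial>lborel)"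
    by (rule lborel_pair.Fubini_integral[OF V1])
  finally show "(\<integral>x. \<Psi> x \<partial>lborel) = (\<integral>y. indicator S y * (\<integral>t. \<Psi> (y + t *\<^sub>R ?e) \<partial>lborel) \<partial>lborel)"
    by (simp add: V_def)
qed

text \<open>The substitution s -> s t rewrites the increment of
  \<open>weak_derivative_increment\<close>, for t of either sign, as a difference of values of an
  indefinite integral.\<close>

lemma integral_segment_eq:
  fixes g :: "real \<Rightarrow> real"
  assumes g: "integrable lborel g"
  shows "(\<integral>s. indicator {0..1} s * (t * g (s * t)) \<partial>lborel)
    = (\<integral>s. indicator {..t} s * g s \<partial>lborel) - (\<integral>s. indicator {..0} s * g s \<partial>lborel)"
proof -
  have [measurable]: "g \<in> borel_measurable borel" using g by auto
  have ii: "integrable lborel (\<lambda>s. indicator {..a} s * g s)" for a :: real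
    by (intro integrable_indicator_mult g) simp
  have "(\<integral>s. indicator {..t} s * g s \<partial>lborel) - (\<integral>s. indicator {..0} s * g s \<partial>lborel)
    = (\<integral>s. indicator {..t} s * g s - indicator {..0} s * g s \<partial>lborel)"
    by (simp add: ii)
  also have "\<dots> = (\<integral>s. indicator {0..1} s * (t * g (s * t)) \<partial>lborel)"
  proof (cases "t = 0")
    case False
    have "(\<integral>s. indicator {..t} s * g s - indicator {..0} s * g s \<partial>lborel)
      = \<bar>t\<bar> *\<^sub>R (\<integral>s. indicator {..t} (0 + t * s) * g (0 + t * s) - indicator {..0} (0 + t * s) * g (0 + t * s) \<partial>lborel)"
      by (rule lborel_integral_real_affine[OF False])
    also have "\<dots> = (\<integral>s. \<bar>t\<bar> * (indicator {..t} (t * s) * g (t * s) - indicator {..0} (t * s) * g (t * s)) \<partial>lborel)"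
      by simp
    also have "\<dots> = (\<integral>s. indicator {0..1} s * (t * g (s * t)) \<partial>lborel)"
    proof (rule integral_cong_AE)
      show "AE s in lborel. \<bar>t\<bar> * (indicator {..t} (t * s) * g (t * s) - indicator {..0} (t * s) * g (t * s))
          = indicator {0..1} s * (t * g (s * t))"
        using AE_lborel_singleton[of 0] AE_lborel_singleton[of 1]
      proof eventually_elim
        case (elim s)
        \<comment> \<open>The points s = 0 and s = 1 are excluded. For negative t the segment is
          traversed backwards, hence the factor sgn t, which combines with |t| to t.\<close>
        have "indicator {..t} (t * s) - indicator {..0} (t * s) = (sgn t * indicator {0..1} s :: real)"
          using False elim
          by (cases "t > 0"; cases "s > 0"; cases "s < 1")
             (auto simp: indicator_def mult_le_0_iff zero_less_mult_iff not_less sgn_if)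
        then have "\<bar>t\<bar> * ((indicator {..t} (t * s) - indicator {..0} (t * s)) * g (t * s))
          = indicator {0..1} s * (sgn t * \<bar>t\<bar> * g (s * t))"
          by (simp add: mult_ac)
        then show ?case by (simp add: left_diff_distrib sgn_mult_abs)
      qed
    qed measurable
    finally show ?thesis .
  qed simp
  finally show ?thesis by simp
qed

text \<open>The set where F is negative is open and null, hence empty.\<close>

lemma AE_lborel_nonneg_continuous:
  fixes F :: "real \<Rightarrow> real"
  assumes F: "continuous_on UNIV F" and nn: "AE t in lborel. 0 \<le> F t"
  shows "0 \<le> F t"
proof (rule ccontr)
  assume "\<not> 0 \<le> F t"
  moreover have op: "open {t. F t < 0}" using F by (intro open_Collect_less continuous_intros)
  moreover have "{t. F t < 0} \<in> null_sets lborel"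
    using nn op by (subst AE_iff_null_sets) (auto simp: not_less)
  then have "negligible {t. F t < 0}"
    by (simp add: negligible_iff_null_sets null_sets_completionI)
  ultimately show False using open_not_negligible[OF op] by (metis empty_iff mem_Collect_eq not_le)
qed

text \<open>f is pinned down only almost everywhere, so the one-dimensional formula is applied on
  almost every line to a continuous function F that agrees with f almost everywhere on it.
  Integrability of the products passes from f to F, and the slab identity reassembles the
  lines.\<close>

lemma integral_by_parts_weak_derivative:
  fixes f g \<phi> :: "real^'d::finite \<Rightarrow> real"
  assumes f: "integrable lborel f" and g: "integrable lborel g"
    and weak: "\<And>u. test_function u \<Longrightarrow>
      (\<integral>x. u x * g x \<partial>lborel) = - (\<integral>x. partial_deriv j u x * f x \<partial>lborel)"
    and f0: "\<And>x. 0 \<le> f x" and g0: "\<And>x. f x = 0 \<Longrightarrow> g x = 0"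
    and \<phi>: "\<And>x. \<phi> differentiable (at x)"
    and i1: "integrable lborel (\<lambda>x. partial_deriv j \<phi> x * f x)"
    and i2: "integrable lborel (\<lambda>x. \<phi> x * g x)"
    and i3: "integrable lborel (\<lambda>x. \<phi> x * f x)"
  shows "(\<integral>x. partial_deriv j \<phi> x * f x + \<phi> x * g x \<partial>lborel) = 0"
proof -
  let ?e = "axis j 1 :: real^'d"
  let ?S = "{y :: real^'d. 0 \<le> y $ j \<and> y $ j \<le> 1}"
  have [measurable]: "f \<in> borel_measurable borel" "g \<in> borel_measurable borel" using f g by auto
  have [measurable]: "\<phi> \<in> borel_measurable borel" "partial_deriv j \<phi> \<in> borel_measurable borel"
    using partial_deriv_borel_measurable[OF \<phi>] by auto
  \<comment> \<open>The exceptional set of the increment formula depends on the shift t. Swapping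
    the quantifiers gives, for almost every y, validity at almost every t.\<close>
  have "AE y in lborel. AE t in lborel. f (y + t *\<^sub>R ?e) - f y
      = (\<integral>s. indicator {0..1} s * (t * g (y + (s * t) *\<^sub>R ?e)) \<partial>lborel)"
  proof (subst lborel_pair.AE_commute)
    show "AE t in lborel. AE y in lborel. f (y + t *\<^sub>R ?e) - f y
      = (\<integral>s. indicator {0..1} s * (t * g (y + (s * t) *\<^sub>R ?e)) \<partial>lborel)"
      by (intro AE_I2 weak_derivative_increment f g weak)
  qed measurable
  moreover note integrable_slab_lines[OF g, of j] integrable_slab_lines[OF i1, of j]
    integrable_slab_lines[OF i2, of j] integrable_slab_lines[OF i3, of j]
  ultimately have "AE y in lborel. y \<in> ?S \<longrightarrow>
    (\<integral>t. partial_deriv j \<phi> (y + t *\<^sub>R ?e) * f (y + t *\<^sub>R ?e) + \<phi> (y + t *\<^sub>R ?e) * g (y + t *\<^sub>R ?e) \<partial>lborel) = 0"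
  proof eventually_elim
    case (elim y)
    show ?case
    proof
      assume yS: "y \<in> ?S"
      define G where "G t = g (y + t *\<^sub>R ?e)" for t
      define I where "I t = (\<integral>s. indicator {..t} s * G s \<partial>lborel)" for t
      \<comment> \<open>The absolutely continuous representative on the line through y, normalized
        by F(0) = f(y).\<close>
      define F where "F t = (f y - I 0) + I t" for t
      have G: "integrable lborel G" unfolding G_def using elim(2) yS by blast
      have [measurable]: "G \<in> borel_measurable borel" unfolding G_def by measurable
      have contF: "continuous_on UNIV F"
        unfolding F_def I_def by (intro continuous_intros continuous_indefinite_lborel_integral G)
      have [measurable]: "F \<in> borel_measurable borel"
        using contF by (rule borel_measurable_continuous_onI)
      have fF: "AE t in lborel. f (y + t *\<^sub>R ?e) = F t"
        using elim(1)
      proof eventually_elim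
        case (elim t)
        then show ?case using integral_segment_eq[OF G, of t] by (simp add: F_def I_def G_def)
      qed
      \<comment> \<open>The one-dimensional formula asks for F \<ge> 0 at every point; continuity
        upgrades the almost-everywhere statement.\<close>
      have "AE t in lborel. 0 \<le> F t"
        using fF by eventually_elim (metis f0)
      then have F0: "0 \<le> F t" for t
        by (rule AE_lborel_nonneg_continuous[OF contF])
      have "(\<integral>t. partial_deriv j \<phi> (y + t *\<^sub>R ?e) * F t + \<phi> (y + t *\<^sub>R ?e) * G t \<partial>lborel) = 0"
      proof (rule integral_by_parts_line[OF G])
        show "F t = (f y - I 0) + (\<integral>s. indicator {..t} s * G s \<partial>lborel)" for t
          by (simp add: F_def I_def)
        show "0 \<le> F t" for t by (rule F0)
        show "AE t in lborel. F t = 0 \<longrightarrow> G t = 0"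
          using fF by eventually_elim (auto simp: G_def g0)
        show "((\<lambda>t. \<phi> (y + t *\<^sub>R ?e)) has_real_derivative partial_deriv j \<phi> (y + t *\<^sub>R ?e)) (at t)" for t
          by (rule has_real_derivative_along_axis[OF \<phi>])
        have "integrable lborel (\<lambda>t. partial_deriv j \<phi> (y + t *\<^sub>R ?e) * f (y + t *\<^sub>R ?e))"
          using elim(3) yS by blast
        then show "integrable lborel (\<lambda>t. partial_deriv j \<phi> (y + t *\<^sub>R ?e) * F t)"
          by (rule integrable_cong_AE_imp) (use fF in \<open>auto elim!: eventually_mono\<close>)
        show "integrable lborel (\<lambda>t. \<phi> (y + t *\<^sub>R ?e) * G t)"
          unfolding G_def using elim(4) yS by blast
        have "integrable lborel (\<lambda>t. \<phi> (y + t *\<^sub>R ?e) * f (y + t *\<^sub>R ?e))"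
          using elim(5) yS by blast
        then show "integrable lborel (\<lambda>t. \<phi> (y + t *\<^sub>R ?e) * F t)"
          by (rule integrable_cong_AE_imp) (use fF in \<open>auto elim!: eventually_mono\<close>)
      qed
      moreover have "(\<integral>t. partial_deriv j \<phi> (y + t *\<^sub>R ?e) * f (y + t *\<^sub>R ?e) + \<phi> (y + t *\<^sub>R ?e) * g (y + t *\<^sub>R ?e) \<partial>lborel)
        = (\<integral>t. partial_deriv j \<phi> (y + t *\<^sub>R ?e) * F t + \<phi> (y + t *\<^sub>R ?e) * G t \<partial>lborel)"
        by (rule integral_cong_AE) (use fF in \<open>auto simp: G_def elim!: eventually_mono\<close>)
      ultimately show "(\<integral>t. partial_deriv j \<phi> (y + t *\<^sub>R ?e) * f (y + t *\<^sub>R ?e) + \<phi> (y + t *\<^sub>R ?e) * g (y + t *\<^sub>R ?e) \<partial>lborel) = 0"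
        by simp
    qed
  qed
  then have "AE y in lborel. indicator ?S y * (\<integral>t. partial_deriv j \<phi> (y + t *\<^sub>R ?e) * f (y + t *\<^sub>R ?e)
      + \<phi> (y + t *\<^sub>R ?e) * g (y + t *\<^sub>R ?e) \<partial>lborel) = 0"
    by eventually_elim (auto simp: indicator_def)
  then show ?thesis
    unfolding integral_slab_lines[OF Bochner_Integration.integrable_add[OF i1 i2], of j]
    by (rule integral_eq_zero_AE)
qed

section \<open>Scores of sums\<close>

lemma (in pair_sigma_finite) integral_pair_swapped:
  fixes H :: "_ \<Rightarrow> real"
  assumes "integrable (M1 \<Otimes>\<^sub>M M2) H"
  shows "integral\<^sup>L (M1 \<Otimes>\<^sub>M M2) H = (\<integral>y. (\<integral>x. H (x, y) \<partial>M1) \<partial>M2)"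
  using integral_snd[of "\<lambda>x y. H (x, y)"] assms by simp

text \<open>Independence makes the joint law a product, so Y can be frozen at y and integrated
  last.\<close>

lemma (in prob_space) indep_var_integral:
  fixes H :: "'b \<times> 'b \<Rightarrow> real"
  assumes ind: "indep_var S X T Y" and H[measurable]: "H \<in> borel_measurable (S \<Otimes>\<^sub>M T)"
    and int: "integrable M (\<lambda>\<omega>. H (X \<omega>, Y \<omega>))"
  shows "(\<integral>\<omega>. H (X \<omega>, Y \<omega>) \<partial>M) = (\<integral>y. (\<integral>\<omega>. H (X \<omega>, y) \<partial>M) \<partial>distr M T Y)"
proof -
  have [measurable]: "X \<in> measurable M S" "Y \<in> measurable M T"
    using ind by (auto dest: indep_var_rv1 indep_var_rv2)
  have eq: "distr M S X \<Otimes>\<^sub>M distr M T Y = distr M (S \<Otimes>\<^sub>M T) (\<lambda>x. (X x, Y x))"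
    using ind unfolding indep_var_distribution_eq by blast
  interpret D1: prob_space "distr M S X" by (rule prob_space_distr) simp
  interpret D2: prob_space "distr M T Y" by (rule prob_space_distr) simp
  interpret P: pair_sigma_finite "distr M S X" "distr M T Y" ..
  have "integrable (distr M S X \<Otimes>\<^sub>M distr M T Y) H"
    unfolding eq using int by (subst integrable_distr_eq) auto
  from P.integral_pair_swapped[OF this]
  have "(\<integral>\<omega>. H (X \<omega>, Y \<omega>) \<partial>M) = (\<integral>y. (\<integral>x. H (x, y) \<partial>distr M S X) \<partial>distr M T Y)"
    unfolding eq by (subst (asm) integral_distr) auto
  also have "\<dots> = (\<integral>y. (\<integral>\<omega>. H (X \<omega>, y) \<partial>M) \<partial>distr M T Y)"
    by (intro Bochner_Integration.integral_cong refl integral_distr) auto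
  finally show ?thesis .
qed

text \<open>Functions of disjoint blocks of an independent family are independent; the blocks here
  are {i} and I.\<close>

lemma (in prob_space) indep_vars_vector_sum:
  fixes X :: "'i \<Rightarrow> 'a \<Rightarrow> 'b::euclidean_space"
  assumes I: "finite I" "i \<notin> I" and indep: "indep_vars (\<lambda>_. borel) X (insert i I)"
  shows "indep_var borel (X i) borel (\<lambda>\<omega>. \<Sum>i\<in>I. X i \<omega>)"
proof -
  have "indep_var
    borel ((\<lambda>f. f i) \<circ> (\<lambda>\<omega>. restrict (\<lambda>i. X i \<omega>) {i}))
    borel ((\<lambda>f. \<Sum>i\<in>I. f i) \<circ> (\<lambda>\<omega>. restrict (\<lambda>i. X i \<omega>) I))"
    using I by (intro indep_var_compose[OF indep_var_restrict[OF indep]]) auto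
  also have "((\<lambda>f. f i) \<circ> (\<lambda>\<omega>. restrict (\<lambda>i. X i \<omega>) {i})) = X i"
    by auto
  also have "((\<lambda>f. \<Sum>i\<in>I. f i) \<circ> (\<lambda>\<omega>. restrict (\<lambda>i. X i \<omega>) I)) = (\<lambda>\<omega>. \<Sum>i\<in>I. X i \<omega>)"
    by (auto cong: rev_conj_cong)
  finally show ?thesis .
qed

lemma (in prob_space) indep_vars_indep_var:
  fixes X :: "'i \<Rightarrow> 'a \<Rightarrow> 'b::euclidean_space"
  assumes "indep_vars (\<lambda>_. borel) X I" "i \<in> I" "j \<in> I" "i \<noteq> j"
  shows "indep_var borel (X i) borel (X j)"
  using indep_vars_vector_sum[of "{j}" i X] indep_vars_subset[OF assms(1), of "{i, j}"] assms by simp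

lemma (in finite_measure) integrable_bounded_compose:
  fixes u :: "'b::topological_space \<Rightarrow> real"
  assumes "Y \<in> borel_measurable M" "u \<in> borel_measurable borel" "\<And>y. \<bar>u y\<bar> \<le> B"
  shows "integrable M (\<lambda>\<omega>. u (Y \<omega>))"
  using assms by (intro integrable_const_bound[of _ B]) auto

lemma (in finite_measure) integrable_bounded_mult:
  fixes u :: "'b::topological_space \<Rightarrow> real"
  assumes [measurable]: "Y \<in> borel_measurable M" "u \<in> borel_measurable borel"
    and B: "\<And>y. \<bar>u y\<bar> \<le> B" and g: "integrable M g"
  shows "integrable M (\<lambda>\<omega>. u (Y \<omega>) * g \<omega>)"
proof (rule Bochner_Integration.integrable_bound)
  show "integrable M (\<lambda>\<omega>. B * g \<omega>)" using g by simp
  have "\<bar>u y\<bar> \<le> \<bar>B\<bar>" for y using B[of y] by linarith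
  then show "AE \<omega> in M. norm (u (Y \<omega>) * g \<omega>) \<le> norm (B * g \<omega>)"
    by (intro AE_I2) (auto simp: abs_mult intro!: mult_right_mono)
  have [measurable]: "g \<in> borel_measurable M" using g by auto
  show "(\<lambda>\<omega>. u (Y \<omega>) * g \<omega>) \<in> borel_measurable M" by measurable
qed

text \<open>A version of the conditional expectation \<open>E[R | Y = y]\<close>.\<close>

lemma (in prob_space) regression_exists_nonneg:
  fixes R :: "'a \<Rightarrow> real" and Y :: "'a \<Rightarrow> 'b::euclidean_space"
  assumes Y[measurable]: "Y \<in> borel_measurable M" and R: "integrable M R" "\<And>\<omega>. 0 \<le> R \<omega>"
  shows "\<exists>h. h \<in> borel_measurable borel \<and> integrable M (\<lambda>\<omega>. h (Y \<omega>)) \<and>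
    (\<forall>u\<in>borel_measurable borel. (\<integral>\<omega>. u (Y \<omega>) * h (Y \<omega>) \<partial>M) = (\<integral>\<omega>. u (Y \<omega>) * R \<omega> \<partial>M))"
proof -
  have [measurable]: "R \<in> borel_measurable M" using R by auto
  define P where "P = distr M borel Y"
  \<comment> \<open>The image under Y of the measure with density R. Its Radon-Nikodym derivative
    with respect to the law of Y is the regression function.\<close>
  define N where "N = distr (density M R) borel Y"
  interpret P: prob_space P unfolding P_def by (rule prob_space_distr) simp
  have sN: "sets N = sets P" by (simp add: N_def P_def)
  have fin: "emeasure N UNIV < \<infinity>"
  proof -
    have "emeasure N UNIV = (\<integral>\<^sup>+\<omega>. R \<omega> \<partial>M)"
      by (simp add: N_def emeasure_distr emeasure_density cong: nn_integral_cong)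
    also have "\<dots> < \<infinity>" using R by (simp add: nn_integral_eq_integral)
    finally show ?thesis .
  qed
  then have finN: "finite_measure N"
    by (intro finite_measureI) (auto simp: N_def)
  have ac: "absolutely_continuous P N"
    unfolding absolutely_continuous_def
  proof
    fix A assume A: "A \<in> null_sets P"
    then have Ab: "A \<in> sets borel" "Y -` A \<inter> space M \<in> null_sets M"
      by (auto simp: P_def null_sets_distr_iff)
    then have "Y -` A \<inter> space M \<in> null_sets (density M R)"
      using AE_not_in[OF Ab(2)] by (subst null_sets_density_iff) (auto elim: eventually_mono)
    then show "A \<in> null_sets N" using Ab(1) by (simp add: N_def null_sets_distr_iff)
  qed
  obtain D where D: "D \<in> borel_measurable P" "AE x in P. RN_deriv P N x = ennreal (D x)" "\<And>x. 0 \<le> D x"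
    using P.real_RN_deriv[OF finN ac sN] by blast
  have [measurable]: "D \<in> borel_measurable borel" using D(1) by (simp add: P_def)
  have "density P D = density P (RN_deriv P N)"
    using D by (intro density_cong) (auto elim: eventually_mono)
  then have dens: "density P D = N" using P.density_RN_deriv[OF ac sN] by simp
  have "(\<integral>\<^sup>+x. D x \<partial>P) = emeasure N UNIV"
    unfolding dens[symmetric] by (subst emeasure_density) (auto simp: P_def cong: nn_integral_cong)
  then have "integrable P D"
    using fin D(1,3) by (intro integrableI_bounded) auto
  then have "integrable M (\<lambda>\<omega>. D (Y \<omega>))"
    by (simp add: P_def integrable_distr_eq)
  moreover have "(\<integral>\<omega>. u (Y \<omega>) * D (Y \<omega>) \<partial>M) = (\<integral>\<omega>. u (Y \<omega>) * R \<omega> \<partial>M)"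
    if [measurable]: "u \<in> borel_measurable borel" for u :: "'b \<Rightarrow> real"
  proof -
    have "(\<integral>\<omega>. u (Y \<omega>) * D (Y \<omega>) \<partial>M) = integral\<^sup>L P (\<lambda>x. D x * u x)"
      unfolding P_def by (subst integral_distr) (auto simp: mult.commute)
    also have "\<dots> = integral\<^sup>L N u"
      unfolding dens[symmetric] using D by (subst integral_density) (auto simp: P_def)
    also have "\<dots> = integral\<^sup>L (density M R) (\<lambda>\<omega>. u (Y \<omega>))"
      unfolding N_def by (subst integral_distr) auto
    also have "\<dots> = (\<integral>\<omega>. u (Y \<omega>) * R \<omega> \<partial>M)"
      using R by (subst integral_density) (auto simp: mult.commute)
    finally show ?thesis .
  qed
  ultimately show ?thesis by (intro exI[of _ D]) auto
qed

text \<open>The regressions of the positive and negative parts are subtracted. Boundedness of u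
  makes both pieces integrable, so that their integrals may be subtracted too.\<close>

lemma (in prob_space) regression_exists:
  fixes R :: "'a \<Rightarrow> real" and Y :: "'a \<Rightarrow> 'b::euclidean_space"
  assumes Y[measurable]: "Y \<in> borel_measurable M" and R: "integrable M R"
  obtains h where "h \<in> borel_measurable borel" "integrable M (\<lambda>\<omega>. h (Y \<omega>))"
    "\<And>u B. u \<in> borel_measurable borel \<Longrightarrow> (\<And>y. \<bar>u y\<bar> \<le> B) \<Longrightarrow>
      (\<integral>\<omega>. u (Y \<omega>) * h (Y \<omega>) \<partial>M) = (\<integral>\<omega>. u (Y \<omega>) * R \<omega> \<partial>M)"
proof -
  have Rp: "integrable M (\<lambda>\<omega>. max 0 (R \<omega>))" "\<And>\<omega>. 0 \<le> max 0 (R \<omega>)"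
    and Rn: "integrable M (\<lambda>\<omega>. max 0 (- R \<omega>))" "\<And>\<omega>. 0 \<le> max 0 (- R \<omega>)"
    using R by simp_all
  obtain h1 where h1: "h1 \<in> borel_measurable borel" "integrable M (\<lambda>\<omega>. h1 (Y \<omega>))"
    "\<forall>u\<in>borel_measurable borel. (\<integral>\<omega>. u (Y \<omega>) * h1 (Y \<omega>) \<partial>M) = (\<integral>\<omega>. u (Y \<omega>) * max 0 (R \<omega>) \<partial>M)"
    using regression_exists_nonneg[OF Y Rp] by blast
  obtain h2 where h2: "h2 \<in> borel_measurable borel" "integrable M (\<lambda>\<omega>. h2 (Y \<omega>))"
    "\<forall>u\<in>borel_measurable borel. (\<integral>\<omega>. u (Y \<omega>) * h2 (Y \<omega>) \<partial>M) = (\<integral>\<omega>. u (Y \<omega>) * max 0 (- R \<omega>) \<partial>M)"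
    using regression_exists_nonneg[OF Y Rn] by blast
  show ?thesis
  proof (rule that[of "\<lambda>y. h1 y - h2 y"])
    show "(\<lambda>y. h1 y - h2 y) \<in> borel_measurable borel" using h1(1) h2(1) by measurable
    show "integrable M (\<lambda>\<omega>. h1 (Y \<omega>) - h2 (Y \<omega>))" using h1(2) h2(2) by auto
    fix u :: "'b \<Rightarrow> real" and B
    assume u[measurable]: "u \<in> borel_measurable borel" and B: "\<And>y. \<bar>u y\<bar> \<le> B"
    note bi = integrable_bounded_mult[OF Y u B]
    have "(\<integral>\<omega>. u (Y \<omega>) * (h1 (Y \<omega>) - h2 (Y \<omega>)) \<partial>M)
      = (\<integral>\<omega>. u (Y \<omega>) * h1 (Y \<omega>) \<partial>M) - (\<integral>\<omega>. u (Y \<omega>) * h2 (Y \<omega>) \<partial>M)"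
      using bi[OF h1(2)] bi[OF h2(2)] by (simp add: right_diff_distrib)
    also have "\<dots> = (\<integral>\<omega>. u (Y \<omega>) * max 0 (R \<omega>) - u (Y \<omega>) * max 0 (- R \<omega>) \<partial>M)"
      using h1(3) h2(3) u bi Rp Rn by simp
    also have "\<dots> = (\<integral>\<omega>. u (Y \<omega>) * R \<omega> \<partial>M)"
      by (intro Bochner_Integration.integral_cong refl) (auto simp: max_def algebra_simps)
    finally show "(\<integral>\<omega>. u (Y \<omega>) * (h1 (Y \<omega>) - h2 (Y \<omega>)) \<partial>M) = (\<integral>\<omega>. u (Y \<omega>) * R \<omega> \<partial>M)" .
  qed
qed

section \<open>Coordinates of vector-valued integrals and of scores\<close>

lemma integrable_vec_iff:
  fixes f :: "'a \<Rightarrow> real^'d::finite"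
  shows "integrable M f \<longleftrightarrow> (\<forall>i. integrable M (\<lambda>x. f x $ i))"
proof
  assume "integrable M f"
  then show "\<forall>i. integrable M (\<lambda>x. f x $ i)"
    by (auto intro: integrable_bounded_linear[OF bounded_linear_vec_nth])
next
  assume *: "\<forall>i. integrable M (\<lambda>x. f x $ i)"
  have "f = (\<lambda>x. \<Sum>i\<in>UNIV. f x $ i *\<^sub>R axis i 1)"
    by (simp add: basis_expansion flip: scalar_mult_eq_scaleR)
  moreover have "integrable M (\<lambda>x. \<Sum>i\<in>UNIV. f x $ i *\<^sub>R axis i (1::real))"
    using * by auto
  ultimately show "integrable M f" by simp
qed

lemma integral_vec_nth:
  fixes f :: "'a \<Rightarrow> 'b::euclidean_space^'d::finite"
  shows "integrable M f \<Longrightarrow> integral\<^sup>L M f $ i = (\<integral>x. f x $ i \<partial>M)"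
  using integral_bounded_linear[OF bounded_linear_vec_nth, of M f i] by simp

lemma borel_measurable_vec_nth [measurable (raw)]:
  fixes f :: "'a \<Rightarrow> 'b::euclidean_space^'d::finite"
  assumes "f \<in> borel_measurable M" shows "(\<lambda>x. f x $ i) \<in> borel_measurable M"
  using measurable_compose[OF assms borel_measurable_continuous_onI[of "\<lambda>x. x $ i"]]
  by (simp add: continuous_on_component)

lemma borel_measurable_vec_lambda:
  fixes f :: "'a \<Rightarrow> 'd::finite \<Rightarrow> real"
  assumes "\<And>i. (\<lambda>x. f x i) \<in> borel_measurable M"
  shows "(\<lambda>x. \<chi> i. f x i) \<in> borel_measurable M"
proof -
  have "(\<lambda>x. \<chi> i. f x i) = (\<lambda>x. \<Sum>i\<in>UNIV. f x i *\<^sub>R axis i 1)"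
    by (auto simp: vec_eq_iff axis_def if_distrib sum.delta cong: if_cong)
  then show ?thesis using assms by simp
qed

text \<open>Test functions and their partial derivatives are bounded, so every integral in the
  definition of a score exists and may be read off coordinatewise. The arguments below work with the
  resulting scalar identities.\<close>

lemma (in finite_measure) is_score_iff_components:
  fixes Y :: "'a \<Rightarrow> real^'d::finite"
  assumes Y[measurable]: "Y \<in> borel_measurable M"
  shows "is_score M Y \<rho> \<longleftrightarrow> \<rho> \<in> borel_measurable borel \<and> (\<forall>j. integrable M (\<lambda>\<omega>. \<rho> (Y \<omega>) $ j)) \<and>
    (\<forall>u j. test_function u \<longrightarrow>
      (\<integral>\<omega>. u (Y \<omega>) * \<rho> (Y \<omega>) $ j \<partial>M) = - (\<integral>\<omega>. partial_deriv j u (Y \<omega>) \<partial>M))"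
proof -
  have "(\<integral>\<omega>. u (Y \<omega>) *\<^sub>R \<rho> (Y \<omega>) \<partial>M) = - (\<integral>\<omega>. grad u (Y \<omega>) \<partial>M) \<longleftrightarrow>
      (\<forall>j. (\<integral>\<omega>. u (Y \<omega>) * \<rho> (Y \<omega>) $ j \<partial>M) = - (\<integral>\<omega>. partial_deriv j u (Y \<omega>) \<partial>M))"
    if \<rho>: "integrable M (\<lambda>\<omega>. \<rho> (Y \<omega>))" and u: "test_function u" for u
  proof -
    have i: "integrable M (\<lambda>\<omega>. u (Y \<omega>) * \<rho> (Y \<omega>) $ j) \<and> integrable M (\<lambda>\<omega>. partial_deriv j u (Y \<omega>))" for j
    proof -
      obtain B where B: "continuous_on UNIV u" "continuous_on UNIV (partial_deriv j u)"
        "\<And>x. \<bar>u x\<bar> \<le> B" "\<And>x. \<bar>partial_deriv j u x\<bar> \<le> B"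
        using test_function_bounds[OF u] by metis
      have [measurable]: "u \<in> borel_measurable borel" "partial_deriv j u \<in> borel_measurable borel"
        using B by (auto intro: borel_measurable_continuous_onI)
      have "integrable M (\<lambda>\<omega>. \<rho> (Y \<omega>) $ j)"
        using \<rho> unfolding integrable_vec_iff by blast
      then show ?thesis
        by (intro conjI integrable_bounded_mult[OF Y _ B(3)] integrable_bounded_compose[OF Y _ B(4)]) measurable
    qed
    then have "integrable M (\<lambda>\<omega>. u (Y \<omega>) *\<^sub>R \<rho> (Y \<omega>))" "integrable M (\<lambda>\<omega>. grad u (Y \<omega>))"
      unfolding integrable_vec_iff by (auto simp: grad_def)
    then show ?thesis
      by (simp add: vec_eq_iff integral_vec_nth grad_def)
  qed
  then show ?thesis
    unfolding is_score_def integrable_vec_iff[symmetric] by auto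
qed

text \<open>The score of the sum is the conditional expectation of the score of one summand.\<close>

lemma (in prob_space) is_score_indep_sum:
  fixes X Y :: "'a \<Rightarrow> real^'d::finite"
  assumes ind: "indep_var borel X borel Y" and \<rho>: "is_score M X \<rho>" and c: "c \<noteq> 0"
  shows "\<exists>\<rho>'. is_score M (\<lambda>\<omega>. c *\<^sub>R (X \<omega> + Y \<omega>)) \<rho>'"
proof -
  let ?W = "\<lambda>\<omega>. c *\<^sub>R (X \<omega> + Y \<omega>)"
  have [measurable]: "X \<in> borel_measurable M" "Y \<in> borel_measurable M"
    using ind by (auto dest: indep_var_rv1 indep_var_rv2)
  have W: "?W \<in> borel_measurable M" by measurable
  have \<rho>m[measurable]: "\<rho> \<in> borel_measurable borel" and \<rho>i: "\<And>j. integrable M (\<lambda>\<omega>. \<rho> (X \<omega>) $ j)"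
    and \<rho>t: "\<And>u j. test_function u \<Longrightarrow> (\<integral>\<omega>. u (X \<omega>) * \<rho> (X \<omega>) $ j \<partial>M) = - (\<integral>\<omega>. partial_deriv j u (X \<omega>) \<partial>M)"
    using \<rho> by (auto simp: is_score_iff_components)
  have comp: "\<exists>h. h \<in> borel_measurable borel \<and> integrable M (\<lambda>\<omega>. h (?W \<omega>)) \<and>
    (\<forall>u. test_function u \<longrightarrow> (\<integral>\<omega>. u (?W \<omega>) * h (?W \<omega>) \<partial>M) = - (\<integral>\<omega>. partial_deriv j u (?W \<omega>) \<partial>M))" for j
  proof -
    \<comment> \<open>The factor 1/c cancels the c that the chain rule produces when x -> u(c (x +
      y)) is differentiated.\<close>
    have R: "integrable M (\<lambda>\<omega>. (1/c) * \<rho> (X \<omega>) $ j)" using \<rho>i by simp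
    obtain h where h: "h \<in> borel_measurable borel" "integrable M (\<lambda>\<omega>. h (?W \<omega>))"
      "\<And>u B. u \<in> borel_measurable borel \<Longrightarrow> (\<And>y. \<bar>u y\<bar> \<le> B) \<Longrightarrow>
        (\<integral>\<omega>. u (?W \<omega>) * h (?W \<omega>) \<partial>M) = (\<integral>\<omega>. u (?W \<omega>) * ((1/c) * \<rho> (X \<omega>) $ j) \<partial>M)"
      using regression_exists[OF W R] by blast
    have "(\<integral>\<omega>. u (?W \<omega>) * h (?W \<omega>) \<partial>M) = - (\<integral>\<omega>. partial_deriv j u (?W \<omega>) \<partial>M)"
      if u: "test_function u" for u
    proof -
      obtain B where B: "continuous_on UNIV u" "continuous_on UNIV (partial_deriv j u)"
        "\<And>x. \<bar>u x\<bar> \<le> B" "\<And>x. \<bar>partial_deriv j u x\<bar> \<le> B"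
        using test_function_bounds[OF u] by metis
      have [measurable]: "u \<in> borel_measurable borel" "partial_deriv j u \<in> borel_measurable borel"
        using B by (auto intro: borel_measurable_continuous_onI)
      \<comment> \<open>With Y frozen at y, the score identity of X is applied to the test function
        x -> u(c x + c y).\<close>
      have slice: "(\<integral>\<omega>. u (c *\<^sub>R (X \<omega> + y)) * ((1/c) * \<rho> (X \<omega>) $ j) \<partial>M)
          = - (\<integral>\<omega>. partial_deriv j u (c *\<^sub>R (X \<omega> + y)) \<partial>M)" for y
      proof -
        have "(\<integral>\<omega>. u (c *\<^sub>R X \<omega> + c *\<^sub>R y) * \<rho> (X \<omega>) $ j \<partial>M)
          = - (\<integral>\<omega>. partial_deriv j (\<lambda>x. u (c *\<^sub>R x + c *\<^sub>R y)) (X \<omega>) \<partial>M)"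
          by (rule \<rho>t[OF test_function_affine[OF u c]])
        also have "\<dots> = - (\<integral>\<omega>. c * partial_deriv j u (c *\<^sub>R X \<omega> + c *\<^sub>R y) \<partial>M)"
          by (subst partial_deriv_affine(2)) (use test_function_differentiable[OF u] in auto)
        finally have "(1/c) * (\<integral>\<omega>. u (c *\<^sub>R X \<omega> + c *\<^sub>R y) * \<rho> (X \<omega>) $ j \<partial>M)
          = - (\<integral>\<omega>. partial_deriv j u (c *\<^sub>R X \<omega> + c *\<^sub>R y) \<partial>M)"
          using c by simp
        then show ?thesis
          by (simp add: scaleR_add_right mult.left_commute flip: integral_mult_right_zero)
      qed
      have "(\<integral>\<omega>. u (?W \<omega>) * h (?W \<omega>) \<partial>M) = (\<integral>\<omega>. u (?W \<omega>) * ((1/c) * \<rho> (X \<omega>) $ j) \<partial>M)"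
        by (rule h(3)[OF _ B(3)]) measurable
      also have "\<dots> = (\<integral>y. (\<integral>\<omega>. u (c *\<^sub>R (X \<omega> + y)) * ((1/c) * \<rho> (X \<omega>) $ j) \<partial>M) \<partial>distr M borel Y)"
      proof -
        have "integrable M (\<lambda>\<omega>. u (?W \<omega>) * ((1/c) * \<rho> (X \<omega>) $ j))"
          using \<rho>i by (intro integrable_bounded_mult[OF W _ B(3)]) auto
        then show ?thesis
          using indep_var_integral[OF ind, of "\<lambda>(x, y). u (c *\<^sub>R (x + y)) * ((1/c) * \<rho> x $ j)"] by simp
      qed
      also have "\<dots> = - (\<integral>y. (\<integral>\<omega>. partial_deriv j u (c *\<^sub>R (X \<omega> + y)) \<partial>M) \<partial>distr M borel Y)"
        unfolding slice by simp
      also have "(\<integral>y. (\<integral>\<omega>. partial_deriv j u (c *\<^sub>R (X \<omega> + y)) \<partial>M) \<partial>distr M borel Y)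
          = (\<integral>\<omega>. partial_deriv j u (?W \<omega>) \<partial>M)"
      proof -
        have "integrable M (\<lambda>\<omega>. partial_deriv j u (?W \<omega>))"
          by (intro integrable_bounded_compose[OF W _ B(4)]) measurable
        then show ?thesis
          using indep_var_integral[OF ind, of "\<lambda>(x, y). partial_deriv j u (c *\<^sub>R (x + y))"] by simp
      qed
      finally show ?thesis .
    qed
    then show ?thesis using h(1,2) by blast
  qed
  obtain h where h: "\<forall>j. h j \<in> borel_measurable borel \<and> integrable M (\<lambda>\<omega>. h j (?W \<omega>)) \<and>
    (\<forall>u. test_function u \<longrightarrow> (\<integral>\<omega>. u (?W \<omega>) * h j (?W \<omega>) \<partial>M) = - (\<integral>\<omega>. partial_deriv j u (?W \<omega>) \<partial>M))"
    by (atomize_elim, rule choice, rule allI, rule comp)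
  have "is_score M ?W (\<lambda>y. \<chi> j. h j y)"
    unfolding is_score_iff_components[OF W] using h by (auto intro: borel_measurable_vec_lambda)
  then show ?thesis by blast
qed

section \<open>A density for the law of a sum\<close>

text \<open>An affine bijection changes Lebesgue measure by a positive constant factor and therefore
  preserves null sets.\<close>

lemma absolutely_continuous_lborel_affine:
  fixes N :: "'b::euclidean_space set"
  assumes N: "AE x in lborel. x \<notin> N" and Nb: "N \<in> sets borel" and c: "c \<noteq> 0"
  shows "AE x in lborel. v + c *\<^sub>R x \<notin> N"
proof -
  note [measurable] = Nb
  have "AE x in density (distr lborel borel (\<lambda>x. v + c *\<^sub>R x)) (\<lambda>_. ennreal (\<bar>c\<bar> ^ DIM('b))). x \<notin> N"
    unfolding lborel_affine[OF c, of v, symmetric] by (rule N)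
  then have "AE x in distr lborel borel (\<lambda>x. v + c *\<^sub>R x). x \<notin> N"
    using c by (subst (asm) AE_density) auto
  then show ?thesis by (subst (asm) AE_distr_iff) auto
qed

text \<open>For each fixed y the variable c (X + y) almost surely misses a given null set, because X
  has a density. By independence the same holds for c (X + Y), and Radon-Nikodym yields the
  density.\<close>

lemma (in prob_space) density_indep_sum:
  fixes X Y :: "'a \<Rightarrow> 'b::euclidean_space"
  assumes ind: "indep_var borel X borel Y" and X: "distributed M lborel X p" and c: "c \<noteq> 0"
  obtains f where "f \<in> borel_measurable borel" "\<And>x. 0 \<le> f x"
    "distr M borel (\<lambda>\<omega>. c *\<^sub>R (X \<omega> + Y \<omega>)) = density lborel (\<lambda>x. ennreal (f x))"
proof -
  let ?W = "\<lambda>\<omega>. c *\<^sub>R (X \<omega> + Y \<omega>)"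
  have [measurable]: "X \<in> borel_measurable M" "Y \<in> borel_measurable M"
    using ind by (auto dest: indep_var_rv1 indep_var_rv2)
  interpret D1: prob_space "distr M borel X" by (rule prob_space_distr) simp
  interpret D2: prob_space "distr M borel Y" by (rule prob_space_distr) simp
  interpret P: pair_sigma_finite "distr M borel X" "distr M borel Y" ..
  interpret W: prob_space "distr M borel ?W" by (rule prob_space_distr) simp
  have lawX: "distr M borel X = density lborel p" and [measurable]: "p \<in> borel_measurable lborel"
    using X by (auto simp: distributed_def cong: distr_cong)
  have ac: "absolutely_continuous lborel (distr M borel ?W)"
    unfolding absolutely_continuous_def
  proof
    fix N :: "'b set" assume N: "N \<in> null_sets lborel"
    then have [measurable]: "N \<in> sets borel" by auto
    have "AE y in distr M borel Y. AE x in distr M borel X. c *\<^sub>R (x + y) \<notin> N"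
    proof (rule AE_I2)
      fix y
      have "AE x in lborel. c *\<^sub>R y + c *\<^sub>R x \<notin> N"
        using AE_not_in[OF N] c by (intro absolutely_continuous_lborel_affine) auto
      then show "AE x in distr M borel X. c *\<^sub>R (x + y) \<notin> N"
        unfolding lawX by (subst AE_density) (auto simp: scaleR_add_right add.commute elim: eventually_mono)
    qed
    then have "AE x in distr M borel X. AE y in distr M borel Y. c *\<^sub>R (x + y) \<notin> N"
      by (rule P.AE_commute[THEN iffD2, rotated]) measurable
    then have "AE z in distr M borel X \<Otimes>\<^sub>M distr M borel Y. c *\<^sub>R (fst z + snd z) \<notin> N"
      by (rule P.AE_pair_iff[THEN iffD1, rotated]) measurable
    also have "distr M borel X \<Otimes>\<^sub>M distr M borel Y = distr M (borel \<Otimes>\<^sub>M borel) (\<lambda>x. (X x, Y x))"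
      using ind unfolding indep_var_distribution_eq by blast
    finally have "AE \<omega> in M. ?W \<omega> \<notin> N"
      by (subst (asm) AE_distr_iff) auto
    then have "AE x in distr M borel ?W. x \<notin> N"
      by (subst AE_distr_iff) auto
    then show "N \<in> null_sets (distr M borel ?W)"
      by (subst AE_iff_null_sets) auto
  qed
  have fm: "finite_measure (distr M borel ?W)"
    by (rule W.finite_measure_axioms)
  obtain D where D: "D \<in> borel_measurable lborel"
    "AE x in lborel. RN_deriv lborel (distr M borel ?W) x = ennreal (D x)" "\<And>x. 0 \<le> D x"
    using sigma_finite_measure.real_RN_deriv[OF sigma_finite_lborel fm ac] by auto
  have "density lborel (\<lambda>x. ennreal (D x)) = density lborel (RN_deriv lborel (distr M borel ?W))"
    using D by (intro density_cong) (auto elim: eventually_mono)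
  also have "\<dots> = distr M borel ?W"
    by (rule sigma_finite_measure.density_RN_deriv[OF sigma_finite_lborel ac]) simp
  finally show ?thesis
    using that[of D] D by simp
qed

section \<open>The variational formula\<close>

lemma integrable_mult_of_squares:
  fixes f g :: "'a \<Rightarrow> real"
  assumes [measurable]: "f \<in> borel_measurable M" "g \<in> borel_measurable M"
    and "integrable M (\<lambda>x. (f x)\<^sup>2)" "integrable M (\<lambda>x. (g x)\<^sup>2)"
  shows "integrable M (\<lambda>x. f x * g x)"
proof (rule Bochner_Integration.integrable_bound)
  show "integrable M (\<lambda>x. (f x)\<^sup>2 + (g x)\<^sup>2)" using assms by simp
  have "\<bar>a * b\<bar> \<le> a\<^sup>2 + b\<^sup>2" for a b :: real
    using sum_squares_bound[of "\<bar>a\<bar>" "\<bar>b\<bar>"] mult_nonneg_nonneg[of "\<bar>a\<bar>" "\<bar>b\<bar>"]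
    unfolding abs_mult power2_abs mult.assoc by linarith
  then show "AE x in M. norm (f x * g x) \<le> norm ((f x)\<^sup>2 + (g x)\<^sup>2)" by simp
qed measurable

lemma (in finite_measure) integrable_of_square:
  fixes f :: "'a \<Rightarrow> real"
  assumes "f \<in> borel_measurable M" "integrable M (\<lambda>x. (f x)\<^sup>2)"
  shows "integrable M f"
  using integrable_mult_of_squares[of f M "\<lambda>_. 1"] assms by simp

text \<open>Cauchy-Schwarz for a second factor of norm at most 1. Expanding the integral of (f - t
  g)^2 with t the integral of f g avoids a division by the norm of g.\<close>

lemma integral_mult_square_le:
  fixes f g :: "'a \<Rightarrow> real"
  assumes m: "f \<in> borel_measurable M" "g \<in> borel_measurable M"
    and f: "integrable M (\<lambda>x. (f x)\<^sup>2)" and g: "integrable M (\<lambda>x. (g x)\<^sup>2)"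
    and g1: "(\<integral>x. (g x)\<^sup>2 \<partial>M) \<le> 1"
  shows "(\<integral>x. f x * g x \<partial>M)\<^sup>2 \<le> (\<integral>x. (f x)\<^sup>2 \<partial>M)"
proof -
  define t where "t = (\<integral>x. f x * g x \<partial>M)"
  have fg: "integrable M (\<lambda>x. f x * g x)" by (rule integrable_mult_of_squares[OF m f g])
  have "0 \<le> (\<integral>x. (f x - t * g x)\<^sup>2 \<partial>M)" by simp
  also have "\<dots> = (\<integral>x. (f x)\<^sup>2 - 2 * t * (f x * g x) + t\<^sup>2 * (g x)\<^sup>2 \<partial>M)"
    by (intro Bochner_Integration.integral_cong refl) (simp add: power2_eq_square algebra_simps)
  also have "\<dots> = (\<integral>x. (f x)\<^sup>2 \<partial>M) - 2 * t * t + t\<^sup>2 * (\<integral>x. (g x)\<^sup>2 \<partial>M)"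
    using f g fg by (simp add: t_def)
  also have "\<dots> \<le> (\<integral>x. (f x)\<^sup>2 \<partial>M) - 2 * t * t + t\<^sup>2 * 1"
    using g1 by (intro add_left_mono mult_left_mono) auto
  finally show ?thesis by (simp add: t_def power2_eq_square)
qed

lemma partial_deriv_shift_scale:
  assumes "u differentiable (at x)"
  shows "partial_deriv j (\<lambda>x. (u x - m) / a) x = partial_deriv j u x / a"
    "(\<lambda>x. (u x - m) / a) differentiable (at x)"
proof -
  have "((\<lambda>x. (u x - m) / a) has_derivative (\<lambda>h. frechet_derivative u (at x) h / a)) (at x)"
    using differentiable_has_frechet_derivative[OF assms]
    by (auto intro!: derivative_eq_intros simp: divide_inverse)
  then show "partial_deriv j (\<lambda>x. (u x - m) / a) x = partial_deriv j u x / a"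
    "(\<lambda>x. (u x - m) / a) differentiable (at x)"
    using partial_deriv_eq differentiableI by (fastforce simp: partial_deriv_def)+
qed

text \<open>Isolates the properties of the normalized sum behind the variational formula. Square
  integrability makes W^j \<phi>(W) integrable for every \<phi> in the class, and the vanishing mean
  makes additive constants in \<phi> invisible.\<close>

locale score_density = prob_space +
  fixes W :: "'a \<Rightarrow> real^'d::finite" and f :: "real^'d \<Rightarrow> real" and \<rho> :: "real^'d \<Rightarrow> real^'d"
  assumes W[measurable]: "W \<in> borel_measurable M"
    and f_measurable[measurable]: "f \<in> borel_measurable borel"
    and f_nonneg: "\<And>x. 0 \<le> f x"
    and law: "distr M borel W = density lborel (\<lambda>x. ennreal (f x))"
    and score: "is_score M W \<rho>"
    and W_square: "\<And>k. integrable M (\<lambda>\<omega>. (W \<omega> $ k)\<^sup>2)"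
    and W_mean: "\<And>k. (\<integral>\<omega>. W \<omega> $ k \<partial>M) = 0"
begin

lemma rho_measurable[measurable]: "\<rho> \<in> borel_measurable borel"
  and rho_integrable: "integrable M (\<lambda>\<omega>. \<rho> (W \<omega>) $ j)"
  and rho_weak: "test_function u \<Longrightarrow> (\<integral>\<omega>. u (W \<omega>) * \<rho> (W \<omega>) $ j \<partial>M) = - (\<integral>\<omega>. partial_deriv j u (W \<omega>) \<partial>M)"
  using score is_score_iff_components[OF W] by auto

lemma W_integrable: "integrable M (\<lambda>\<omega>. W \<omega> $ k)"
  by (rule integrable_of_square[OF _ W_square]) simp

lemma integrable_law: 
  fixes h :: "real^'d \<Rightarrow> real"
  assumes [measurable]: "h \<in> borel_measurable borel"
  shows "integrable M (\<lambda>\<omega>. h (W \<omega>)) \<longleftrightarrow> integrable lborel (\<lambda>x. h x * f x)"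
proof -
  have "integrable M (\<lambda>\<omega>. h (W \<omega>)) \<longleftrightarrow> integrable (distr M borel W) h"
    by (rule integrable_distr_eq[symmetric]) measurable
  also have "\<dots> \<longleftrightarrow> integrable lborel (\<lambda>x. h x * f x)"
    unfolding law using f_nonneg by (subst integrable_density) (auto simp: mult.commute)
  finally show ?thesis .
qed

lemma integral_law:
  fixes h :: "real^'d \<Rightarrow> real"
  assumes [measurable]: "h \<in> borel_measurable borel"
  shows "(\<integral>\<omega>. h (W \<omega>) \<partial>M) = (\<integral>x. h x * f x \<partial>lborel)"
proof -
  have "(\<integral>\<omega>. h (W \<omega>) \<partial>M) = integral\<^sup>L (distr M borel W) h"
    by (rule integral_distr[symmetric]) measurable
  also have "\<dots> = (\<integral>x. h x * f x \<partial>lborel)"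
    unfolding law using f_nonneg by (subst integral_density) (auto simp: mult.commute)
  finally show ?thesis .
qed

lemma AE_law:
  assumes P: "AE x in lborel. P x" and [measurable]: "{x. P x} \<in> sets borel"
  shows "AE \<omega> in M. P (W \<omega>)"
proof -
  have "AE x in distr M borel W. P x"
    unfolding law using P by (subst AE_density) (auto elim: eventually_mono)
  then show ?thesis by (subst (asm) AE_distr_iff) auto
qed

text \<open>For g = \<rho>_j f the score identity says that g is the weak j-th derivative of f, and
  this g vanishes wherever f does.\<close>

lemma score_integral_by_parts:
  assumes \<phi>: "\<And>x. \<phi> differentiable (at x)"
    and i1: "integrable M (\<lambda>\<omega>. partial_deriv j \<phi> (W \<omega>))"
    and i2: "integrable M (\<lambda>\<omega>. \<phi> (W \<omega>) * \<rho> (W \<omega>) $ j)"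
    and i3: "integrable M (\<lambda>\<omega>. \<phi> (W \<omega>))"
  shows "(\<integral>\<omega>. partial_deriv j \<phi> (W \<omega>) \<partial>M) = - (\<integral>\<omega>. \<phi> (W \<omega>) * \<rho> (W \<omega>) $ j \<partial>M)"
proof -
  note [measurable] = partial_deriv_borel_measurable[OF \<phi>]
  define g where "g x = \<rho> x $ j * f x" for x
  have I1: "integrable lborel (\<lambda>x. partial_deriv j \<phi> x * f x)"
    using i1 by (subst integrable_law[symmetric]) auto
  have "integrable lborel (\<lambda>x. (\<phi> x * \<rho> x $ j) * f x)"
    using i2 by (subst integrable_law[symmetric]) auto
  then have I2: "integrable lborel (\<lambda>x. \<phi> x * g x)" by (simp add: g_def mult.assoc)
  have I3: "integrable lborel (\<lambda>x. \<phi> x * f x)"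
    using i3 by (subst integrable_law[symmetric]) auto
  have "(\<integral>x. partial_deriv j \<phi> x * f x + \<phi> x * g x \<partial>lborel) = 0"
  proof (rule integral_by_parts_weak_derivative[OF _ _ _ f_nonneg _ \<phi> I1 I2 I3])
    show "integrable lborel f"
      using integrable_law[of "\<lambda>_. 1"] by simp
    show "integrable lborel g"
      unfolding g_def using rho_integrable by (subst integrable_law[symmetric]) auto
    show "g x = 0" if "f x = 0" for x using that by (simp add: g_def)
    fix u :: "real^'d \<Rightarrow> real" assume u: "test_function u"
    note [measurable] = partial_deriv_borel_measurable[OF test_function_differentiable[OF u]]
    have "(\<integral>x. u x * g x \<partial>lborel) = (\<integral>x. (u x * \<rho> x $ j) * f x \<partial>lborel)"
      by (simp add: g_def mult.assoc)
    also have "\<dots> = (\<integral>\<omega>. u (W \<omega>) * \<rho> (W \<omega>) $ j \<partial>M)"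
      by (rule integral_law[symmetric]) measurable
    also have "\<dots> = - (\<integral>\<omega>. partial_deriv j u (W \<omega>) \<partial>M)" by (rule rho_weak[OF u])
    also have "\<dots> = - (\<integral>x. partial_deriv j u x * f x \<partial>lborel)"
      by (subst integral_law) auto
    finally show "(\<integral>x. u x * g x \<partial>lborel) = - (\<integral>x. partial_deriv j u x * f x \<partial>lborel)" .
  qed
  then have "(\<integral>x. partial_deriv j \<phi> x * f x \<partial>lborel) = - (\<integral>x. (\<phi> x * \<rho> x $ j) * f x \<partial>lborel)"
    using I1 I2 by (simp add: g_def mult.assoc)
  then show ?thesis
    by (subst (1 2) integral_law) auto
qed

text \<open>Component j of Z in the case of identity covariance, where the inverse covariance in
  front of W disappears.\<close>

definition std_score :: "'d \<Rightarrow> real^'d \<Rightarrow> real" where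
  "std_score j x = \<rho> x $ j + x $ j"

lemma std_score_measurable[measurable]: "std_score j \<in> borel_measurable borel"
  unfolding std_score_def by measurable

lemma std_score_integrable: "integrable M (\<lambda>\<omega>. std_score j (W \<omega>))"
  unfolding std_score_def using rho_integrable W_integrable by auto

definition stein_value :: "'d \<Rightarrow> (real^'d \<Rightarrow> real) \<Rightarrow> real" where
  "stein_value j \<phi> = (\<integral>\<omega>. partial_deriv j \<phi> (W \<omega>) - W \<omega> $ j * \<phi> (W \<omega>) \<partial>M)"

text \<open>Integration by parts requires \<phi> \<rho>_j to be integrable. It is, being Z_j \<phi>
  - W^j \<phi>, a difference of products of square-integrable functions.\<close>

lemma stein_value_le:
  assumes Z: "integrable M (\<lambda>\<omega>. (std_score j (W \<omega>))\<^sup>2)" and \<phi>: "\<phi> \<in> H_class M W"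
  shows "(stein_value j \<phi>)\<^sup>2 \<le> (\<integral>\<omega>. (std_score j (W \<omega>))\<^sup>2 \<partial>M)"
proof -
  have d: "\<And>x. \<phi> differentiable (at x)" and i1: "integrable M (\<lambda>\<omega>. partial_deriv j \<phi> (W \<omega>))"
    and sq: "integrable M (\<lambda>\<omega>. (\<phi> (W \<omega>))\<^sup>2)" and le1: "(\<integral>\<omega>. (\<phi> (W \<omega>))\<^sup>2 \<partial>M) \<le> 1"
    using \<phi> by (auto simp: H_class_def)
  note [measurable] = partial_deriv_borel_measurable[OF d]
  have i3: "integrable M (\<lambda>\<omega>. \<phi> (W \<omega>))"
    by (rule integrable_of_square[OF _ sq]) measurable
  have zf: "integrable M (\<lambda>\<omega>. std_score j (W \<omega>) * \<phi> (W \<omega>))"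
    and wf: "integrable M (\<lambda>\<omega>. W \<omega> $ j * \<phi> (W \<omega>))"
    by (intro integrable_mult_of_squares Z sq W_square; measurable)+
  have "integrable M (\<lambda>\<omega>. std_score j (W \<omega>) * \<phi> (W \<omega>) - W \<omega> $ j * \<phi> (W \<omega>))"
    using zf wf by simp
  then have i2: "integrable M (\<lambda>\<omega>. \<phi> (W \<omega>) * \<rho> (W \<omega>) $ j)"
    by (simp add: std_score_def algebra_simps)
  have "stein_value j \<phi> = - (\<integral>\<omega>. \<phi> (W \<omega>) * \<rho> (W \<omega>) $ j \<partial>M) - (\<integral>\<omega>. W \<omega> $ j * \<phi> (W \<omega>) \<partial>M)"
    using i1 wf score_integral_by_parts[OF d i1 i2 i3] by (simp add: stein_value_def)
  also have "\<dots> = - (\<integral>\<omega>. \<phi> (W \<omega>) * \<rho> (W \<omega>) $ j + W \<omega> $ j * \<phi> (W \<omega>) \<partial>M)"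
    using i2 wf by simp
  also have "\<dots> = - (\<integral>\<omega>. std_score j (W \<omega>) * \<phi> (W \<omega>) \<partial>M)"
    by (simp add: std_score_def algebra_simps)
  finally have "(stein_value j \<phi>)\<^sup>2 = (\<integral>\<omega>. std_score j (W \<omega>) * \<phi> (W \<omega>) \<partial>M)\<^sup>2" by simp
  also have "\<dots> \<le> (\<integral>\<omega>. (std_score j (W \<omega>))\<^sup>2 \<partial>M)"
    by (intro integral_mult_square_le Z sq le1) measurable
  finally show ?thesis .
qed

text \<open>Centring does not increase the second moment, so division by a lands in the class. The
  subtracted constant leaves the Stein value alone: its derivative is 0 and W has mean 0.\<close>

lemma normalized_test_function_in_H_class:
  assumes u: "test_function u" and a: "a > 0" "(\<integral>\<omega>. (u (W \<omega>))\<^sup>2 \<partial>M) \<le> a\<^sup>2"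
  defines "\<phi> \<equiv> \<lambda>x. (u x - (\<integral>\<omega>. u (W \<omega>) \<partial>M)) / a"
  shows "\<phi> \<in> H_class M W"
    and "stein_value j \<phi> = - (\<integral>\<omega>. std_score j (W \<omega>) * u (W \<omega>) \<partial>M) / a"
proof -
  define m where "m = (\<integral>\<omega>. u (W \<omega>) \<partial>M)"
  have \<phi>: "\<phi> = (\<lambda>x. (u x - m) / a)" by (simp add: \<phi>_def m_def)
  have du: "u differentiable (at x)" for x by (rule test_function_differentiable[OF u])
  note pd = partial_deriv_shift_scale[OF du]
  note [measurable] = partial_deriv_borel_measurable[OF du]
  have bd: "integrable M (\<lambda>\<omega>. u (W \<omega>)) \<and> integrable M (\<lambda>\<omega>. (u (W \<omega>))\<^sup>2) \<and>
    integrable M (\<lambda>\<omega>. partial_deriv k u (W \<omega>)) \<and>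
    integrable M (\<lambda>\<omega>. u (W \<omega>) * W \<omega> $ k) \<and> integrable M (\<lambda>\<omega>. u (W \<omega>) * \<rho> (W \<omega>) $ k)" for k
  proof -
    obtain B where B: "continuous_on UNIV u" "continuous_on UNIV (partial_deriv k u)"
      "\<And>x. \<bar>u x\<bar> \<le> B" "\<And>x. \<bar>partial_deriv k u x\<bar> \<le> B"
      using test_function_bounds[OF u] by metis
    have i: "integrable M (\<lambda>\<omega>. u (W \<omega>))"
      by (rule integrable_bounded_compose[OF W _ B(3)]) measurable
    have "integrable M (\<lambda>\<omega>. u (W \<omega>) * u (W \<omega>))"
      by (rule integrable_bounded_mult[OF W _ B(3) i]) measurable
    moreover have "integrable M (\<lambda>\<omega>. partial_deriv k u (W \<omega>))"
      by (rule integrable_bounded_compose[OF W _ B(4)]) measurable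
    moreover have "integrable M (\<lambda>\<omega>. u (W \<omega>) * W \<omega> $ k)"
      by (rule integrable_bounded_mult[OF W _ B(3) W_integrable]) measurable
    moreover have "integrable M (\<lambda>\<omega>. u (W \<omega>) * \<rho> (W \<omega>) $ k)"
      by (rule integrable_bounded_mult[OF W _ B(3) rho_integrable]) measurable
    ultimately show ?thesis using i by (simp add: power2_eq_square)
  qed
  have sq: "(\<phi> x)\<^sup>2 = ((u x)\<^sup>2 - 2 * m * u x + m\<^sup>2) / a\<^sup>2" for x
    by (simp add: \<phi> power_divide power2_diff algebra_simps)
  have i2: "integrable M (\<lambda>\<omega>. (\<phi> (W \<omega>))\<^sup>2)"
    unfolding sq using bd by simp
  have "(\<integral>\<omega>. (\<phi> (W \<omega>))\<^sup>2 \<partial>M) = ((\<integral>\<omega>. (u (W \<omega>))\<^sup>2 \<partial>M) - 2 * m * m + m\<^sup>2) / a\<^sup>2"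
    unfolding sq using bd by (simp add: m_def prob_space)
  also have "\<dots> \<le> a\<^sup>2 / a\<^sup>2"
  proof (rule divide_right_mono)
    have "0 \<le> m * m" by simp
    then show "(\<integral>\<omega>. (u (W \<omega>))\<^sup>2 \<partial>M) - 2 * m * m + m\<^sup>2 \<le> a\<^sup>2"
      using a(2) unfolding power2_eq_square[of m] by linarith
  qed simp
  also have "\<dots> = 1" using a by simp
  finally have le: "(\<integral>\<omega>. (\<phi> (W \<omega>))\<^sup>2 \<partial>M) \<le> 1" .
  have "(\<integral>\<omega>. \<phi> (W \<omega>) \<partial>M) = 0"
    unfolding \<phi> using bd by (simp add: m_def prob_space)
  with i2 le show "\<phi> \<in> H_class M W"
    using bd pd by (simp add: H_class_def \<phi>)
  have "stein_value j \<phi> = (\<integral>\<omega>. (partial_deriv j u (W \<omega>) - u (W \<omega>) * W \<omega> $ j + m * W \<omega> $ j) / a \<partial>M)"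
    unfolding stein_value_def \<phi> pd
    by (intro Bochner_Integration.integral_cong refl) (simp add: diff_divide_distrib add_divide_distrib algebra_simps)
  also have "\<dots> = ((\<integral>\<omega>. partial_deriv j u (W \<omega>) \<partial>M) - (\<integral>\<omega>. u (W \<omega>) * W \<omega> $ j \<partial>M)) / a"
    using bd W_integrable by (simp add: W_mean)
  also have "\<dots> = - ((\<integral>\<omega>. u (W \<omega>) * \<rho> (W \<omega>) $ j \<partial>M) + (\<integral>\<omega>. u (W \<omega>) * W \<omega> $ j \<partial>M)) / a"
    using rho_weak[OF u, of j] by simp
  also have "\<dots> = - (\<integral>\<omega>. u (W \<omega>) * \<rho> (W \<omega>) $ j + u (W \<omega>) * W \<omega> $ j \<partial>M) / a"
    using bd by simp
  finally show "stein_value j \<phi> = - (\<integral>\<omega>. std_score j (W \<omega>) * u (W \<omega>) \<partial>M) / a"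
    by (simp add: std_score_def algebra_simps)
qed

text \<open>Let e = E[g(W)^2]. Bounded test functions u_m converging to g satisfy E[Z_j u_m(W)] -> e
  and E[u_m(W)^2] -> e. Normalizing them by any a > 0 with a^2 > e gives e^2 \<le> s a^2, and
  letting a^2 decrease to e leaves e^2 \<le> s e.\<close>

lemma truncated_second_moment_le:
  assumes s: "\<And>\<phi>. \<phi> \<in> H_class M W \<Longrightarrow> (stein_value j \<phi>)\<^sup>2 \<le> s" and K: "K \<ge> 0"
  defines "g \<equiv> \<lambda>x. if \<bar>std_score j x\<bar> \<le> K then std_score j x else 0"
  shows "(\<integral>\<omega>. (g (W \<omega>))\<^sup>2 \<partial>M) \<le> s"
proof -
  have [measurable]: "g \<in> borel_measurable borel" unfolding g_def by measurable
  have gK: "\<bar>g x\<bar> \<le> K" for x using K by (simp add: g_def)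
  obtain u where u: "\<And>m::nat. test_function (u m)" "\<And>m x. \<bar>u m x\<bar> \<le> K + 1"
    "AE x in lborel. (\<lambda>m. u m x) \<longlonglongrightarrow> g x"
    using test_function_approx[of g K] gK by auto
  note [measurable] = test_function_borel_measurable[OF u(1)]
  have lim: "AE \<omega> in M. (\<lambda>m. u m (W \<omega>)) \<longlonglongrightarrow> g (W \<omega>)"
    by (rule AE_law[OF u(3)]) measurable
  define e where "e = (\<integral>\<omega>. (g (W \<omega>))\<^sup>2 \<partial>M)"
  have lim1: "(\<lambda>m. \<integral>\<omega>. std_score j (W \<omega>) * u m (W \<omega>) \<partial>M) \<longlonglongrightarrow> (\<integral>\<omega>. std_score j (W \<omega>) * g (W \<omega>) \<partial>M)"
  proof (rule integral_dominated_convergence[where w="\<lambda>\<omega>. \<bar>std_score j (W \<omega>)\<bar> * (K + 1)"])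
    show "AE \<omega> in M. (\<lambda>m. std_score j (W \<omega>) * u m (W \<omega>)) \<longlonglongrightarrow> std_score j (W \<omega>) * g (W \<omega>)"
      using lim by eventually_elim (intro tendsto_intros)
  qed (use u(2) std_score_integrable in \<open>auto simp: abs_mult intro!: mult_left_mono\<close>)
  \<comment> \<open>Wherever the truncation g is nonzero it equals Z_j, so Z_j g = g^2.\<close>
  also have "(\<lambda>\<omega>. std_score j (W \<omega>) * g (W \<omega>)) = (\<lambda>\<omega>. (g (W \<omega>))\<^sup>2)"
    by (auto simp: g_def power2_eq_square)
  finally have lim1: "(\<lambda>m. \<integral>\<omega>. std_score j (W \<omega>) * u m (W \<omega>) \<partial>M) \<longlonglongrightarrow> e"
    by (simp add: e_def)
  have lim2: "(\<lambda>m. \<integral>\<omega>. (u m (W \<omega>))\<^sup>2 \<partial>M) \<longlonglongrightarrow> e"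
    unfolding e_def
  proof (rule integral_dominated_convergence[where w="\<lambda>\<omega>. (K + 1)\<^sup>2"])
    show "AE \<omega> in M. (\<lambda>m. (u m (W \<omega>))\<^sup>2) \<longlonglongrightarrow> (g (W \<omega>))\<^sup>2"
      using lim by eventually_elim (intro tendsto_intros)
    show "AE \<omega> in M. norm ((u m (W \<omega>))\<^sup>2) \<le> (K + 1)\<^sup>2" for m
      using u(2)[of m] K by (auto intro!: AE_I2 simp: abs_le_square_iff[symmetric])
  qed auto
  \<comment> \<open>The strict inequality guarantees E[u_m(W)^2] < a^2 for all large m, so the
    normalized u_m eventually belongs to the class.\<close>
  have key: "e\<^sup>2 \<le> s * a\<^sup>2" if a: "a > 0" "e < a\<^sup>2" for a
  proof (rule tendsto_upperbound[OF tendsto_power[OF lim1]])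
    show "\<forall>\<^sub>F m in sequentially. (\<integral>\<omega>. std_score j (W \<omega>) * u m (W \<omega>) \<partial>M)\<^sup>2 \<le> s * a\<^sup>2"
      using order_tendstoD(2)[OF lim2 a(2)]
    proof eventually_elim
      case (elim m)
      from normalized_test_function_in_H_class[OF u(1) a(1) less_imp_le[OF elim]]
      have "(- (\<integral>\<omega>. std_score j (W \<omega>) * u m (W \<omega>) \<partial>M) / a)\<^sup>2 \<le> s"
        using s by metis
      then show ?case using a(1) by (simp add: power_divide field_simps)
    qed
  qed simp
  have e0: "0 \<le> e" by (simp add: e_def)
  have key2: "e\<^sup>2 \<le> s * (e + \<epsilon>)" if "\<epsilon> > 0" for \<epsilon>
    using key[of "sqrt (e + \<epsilon>)"] that e0 by simp
  have "((\<lambda>\<epsilon>. s * (e + \<epsilon>)) \<longlongrightarrow> s * (e + 0)) (at_right 0)"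
    by (intro tendsto_intros)
  then have "e\<^sup>2 \<le> s * (e + 0)"
    by (rule tendsto_lowerbound) (auto simp: eventually_at_filter key2)
  then have "e * e \<le> s * e" by (simp add: power2_eq_square)
  \<comment> \<open>Cancelling e from e^2 \<le> s e says nothing when e = 0. That case needs s \<ge>
    0, obtained from \<open>key\<close> with a^2 = e + 1.\<close>
  moreover have "0 \<le> s"
  proof -
    have "0 \<le> e\<^sup>2" by simp
    also have "\<dots> \<le> s * (sqrt (e + 1))\<^sup>2" using e0 by (intro key) auto
    finally show ?thesis using e0 by (simp add: zero_le_mult_iff)
  qed
  ultimately have "e \<le> s" using e0 by (cases "e = 0") auto
  then show ?thesis by (simp add: e_def)
qed

text \<open>The bound on the truncations is uniform in the level n, so monotone convergence yields
  square integrability together with the bound.\<close>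

lemma second_moment_le:
  assumes s: "\<And>\<phi>. \<phi> \<in> H_class M W \<Longrightarrow> (stein_value j \<phi>)\<^sup>2 \<le> s"
  shows "integrable M (\<lambda>\<omega>. (std_score j (W \<omega>))\<^sup>2)" "(\<integral>\<omega>. (std_score j (W \<omega>))\<^sup>2 \<partial>M) \<le> s"
proof -
  define g where "g n x = (if \<bar>std_score j x\<bar> \<le> real n then std_score j x else 0)" for n x
  have [measurable]: "g n \<in> borel_measurable borel" for n unfolding g_def by measurable
  have le: "(\<integral>\<omega>. (g n (W \<omega>))\<^sup>2 \<partial>M) \<le> s" for n
    unfolding g_def using truncated_second_moment_le[OF s, of "real n"] by simp
  have int: "integrable M (\<lambda>\<omega>. (g n (W \<omega>))\<^sup>2)" for n
    by (intro integrable_const_bound[of _ "(real n)\<^sup>2"]) (auto simp: g_def abs_le_square_iff[symmetric])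
  have mono: "mono (\<lambda>n. (g n x)\<^sup>2)" for x
    by (auto simp: mono_def g_def)
  have "incseq (\<lambda>n. \<integral>\<omega>. (g n (W \<omega>))\<^sup>2 \<partial>M)"
    using mono by (auto simp: incseq_def mono_def intro!: integral_mono int)
  then obtain L where L: "(\<lambda>n. \<integral>\<omega>. (g n (W \<omega>))\<^sup>2 \<partial>M) \<longlonglongrightarrow> L"
    using incseq_convergent[of _ s] le by blast
  have lim: "(\<lambda>n. (g n x)\<^sup>2) \<longlonglongrightarrow> (std_score j x)\<^sup>2" for x
  proof (rule tendsto_eventually)
    show "\<forall>\<^sub>F n in sequentially. (g n x)\<^sup>2 = (std_score j x)\<^sup>2"
      using eventually_ge_at_top[of "nat \<lceil>\<bar>std_score j x\<bar>\<rceil>"]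
    proof eventually_elim
      case (elim n)
      then have "\<bar>std_score j x\<bar> \<le> real n" by linarith
      then show ?case by (simp add: g_def)
    qed
  qed
  note mc = int AE_I2[OF mono] AE_I2[OF lim] L
  show "integrable M (\<lambda>\<omega>. (std_score j (W \<omega>))\<^sup>2)"
    by (rule integrable_monotone_convergence[OF mc]) measurable
  have "(\<integral>\<omega>. (std_score j (W \<omega>))\<^sup>2 \<partial>M) = L"
    by (rule integral_monotone_convergence[OF mc]) measurable
  also have "L \<le> s" using L le by (intro LIMSEQ_le_const2) auto
  finally show "(\<integral>\<omega>. (std_score j (W \<omega>))\<^sup>2 \<partial>M) \<le> s" .
qed

text \<open>Makes the supremum nonnegative; over an empty class it would be minus infinity in the
  extended reals.\<close>

lemma zero_in_H_class: "(\<lambda>_. 0) \<in> H_class M W"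
proof -
  have "partial_deriv j (\<lambda>_::real^'d. 0) = (\<lambda>_. 0)" for j
    by (rule ext) (rule partial_deriv_eq[OF has_derivative_const])
  then show ?thesis by (simp add: H_class_def)
qed

text \<open>A finite supremum is a real bound for all squared Stein values and so forces Z_j to be
  square integrable. Contrapositively, the supremum is infinite when Z_j is not.\<close>

lemma SUP_stein_value:
  "(SUP \<phi>\<in>H_class M W. ereal ((stein_value j \<phi>)\<^sup>2)) =
    (if integrable M (\<lambda>\<omega>. (std_score j (W \<omega>))\<^sup>2) then ereal (\<integral>\<omega>. (std_score j (W \<omega>))\<^sup>2 \<partial>M) else \<infinity>)"
proof -
  let ?S = "SUP \<phi>\<in>H_class M W. ereal ((stein_value j \<phi>)\<^sup>2)"
  have "0 \<le> ?S"
    by (rule SUP_upper2[OF zero_in_H_class]) simp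
  have lower: "integrable M (\<lambda>\<omega>. (std_score j (W \<omega>))\<^sup>2) \<and> ereal (\<integral>\<omega>. (std_score j (W \<omega>))\<^sup>2 \<partial>M) \<le> ?S"
    if fin: "?S \<noteq> \<infinity>"
  proof -
    obtain s where s: "?S = ereal s" using fin \<open>0 \<le> ?S\<close> by (cases ?S) auto
    have "(stein_value j \<phi>)\<^sup>2 \<le> s" if "\<phi> \<in> H_class M W" for \<phi>
      using SUP_upper[OF that, of "\<lambda>\<phi>. ereal ((stein_value j \<phi>)\<^sup>2)"] s by simp
    from second_moment_le[OF this] show ?thesis by (simp add: s)
  qed
  show ?thesis
  proof (cases "integrable M (\<lambda>\<omega>. (std_score j (W \<omega>))\<^sup>2)")
    case True
    then have le: "?S \<le> ereal (\<integral>\<omega>. (std_score j (W \<omega>))\<^sup>2 \<partial>M)"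
      by (auto intro!: SUP_least stein_value_le)
    then have "?S \<noteq> \<infinity>" by auto
    from antisym[OF le lower[OF this, THEN conjunct2]] show ?thesis
      unfolding if_P[OF True] .
  next
    case False
    have "?S = \<infinity>"
    proof (rule ccontr)
      assume "?S \<noteq> \<infinity>"
      from False lower[OF this, THEN conjunct1] show False by (rule notE)
    qed
    then show ?thesis unfolding if_not_P[OF False] .
  qed
qed

end

section \<open>The normalized sum\<close>

lemma integrable_matrix_iff:
  fixes A :: "'a \<Rightarrow> real^'m::finite^'n::finite"
  shows "integrable M A \<longleftrightarrow> (\<forall>i j. integrable M (\<lambda>x. A x $ i $ j))"
proof
  assume "integrable M A"
  then have "integrable M (\<lambda>x. A x $ i)" for i
    by (rule integrable_bounded_linear[OF bounded_linear_vec_nth])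
  then show "\<forall>i j. integrable M (\<lambda>x. A x $ i $ j)"
    by (simp add: integrable_vec_iff)
next
  assume *: "\<forall>i j. integrable M (\<lambda>x. A x $ i $ j)"
  have ax: "bounded_linear (axis i :: real^'m \<Rightarrow> real^'m^'n)" for i
    by (intro linear_conv_bounded_linear[THEN iffD1] linearI) (auto simp: vec_eq_iff axis_def)
  have "integrable M (\<lambda>x. \<Sum>i\<in>UNIV. axis i (A x $ i))"
    using * by (intro Bochner_Integration.integrable_sum integrable_bounded_linear[OF ax])
      (simp add: integrable_vec_iff)
  also have "(\<lambda>x. \<Sum>i\<in>UNIV. axis i (A x $ i)) = A"
    by (auto simp: vec_eq_iff axis_def if_distrib if_distribR cong: if_cong)
  finally show "integrable M A" .
qed

lemma integral_matrix_nth: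
  fixes A :: "'a \<Rightarrow> real^'m::finite^'n::finite"
  assumes "integrable M A"
  shows "integral\<^sup>L M A $ i $ j = (\<integral>x. A x $ i $ j \<partial>M)"
  using integral_vec_nth[OF assms, of i]
    integral_vec_nth[OF integrable_bounded_linear[OF bounded_linear_vec_nth assms], of i j] by simp

text \<open>The squares are the diagonal entries, and an off-diagonal entry is a product of two
  square-integrable components.\<close>

lemma integrable_outer_iff:
  assumes [measurable]: "Z \<in> borel_measurable M"
  shows "integrable M (\<lambda>\<omega>. outer (Z \<omega>) (Z \<omega>)) \<longleftrightarrow> (\<forall>j. integrable M (\<lambda>\<omega>. (Z \<omega> $ j)\<^sup>2))"
  unfolding integrable_matrix_iff
proof (intro iffI allI)
  fix j assume "\<forall>i j. integrable M (\<lambda>x. outer (Z x) (Z x) $ i $ j)"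
  from this[rule_format, of j j] show "integrable M (\<lambda>\<omega>. (Z \<omega> $ j)\<^sup>2)"
    by (simp add: outer_def power2_eq_square)
next
  fix i j assume "\<forall>j. integrable M (\<lambda>\<omega>. (Z \<omega> $ j)\<^sup>2)"
  then have "integrable M (\<lambda>x. Z x $ i * Z x $ j)"
    by (intro integrable_mult_of_squares) auto
  then show "integrable M (\<lambda>x. outer (Z x) (Z x) $ i $ j)"
    by (simp add: outer_def)
qed

lemma integrable_component_square:
  fixes Z :: "'a \<Rightarrow> real^'d::finite"
  assumes [measurable]: "Z \<in> borel_measurable M" and "integrable M (\<lambda>\<omega>. (norm (Z \<omega>))\<^sup>2)"
  shows "integrable M (\<lambda>\<omega>. (Z \<omega> $ j)\<^sup>2)"
proof (rule Bochner_Integration.integrable_bound[OF assms(2)])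
  show "AE \<omega> in M. norm ((Z \<omega> $ j)\<^sup>2) \<le> norm ((norm (Z \<omega>))\<^sup>2)"
    using component_le_norm_cart[of "Z _" j] by (intro AE_I2) (simp add: abs_le_square_iff[symmetric])
qed measurable

text \<open>With identity covariance the trace is the sum of the diagonal entries E[Z_j^2]. In the
  divergent case one infinite summand makes the whole sum infinite, in agreement with the default
  value in \<open>J_st\<close>.\<close>

lemma (in score_density) J_st_eq:
  assumes cov: "covariance_matrix M W = mat 1" and \<rho>: "\<rho> = score M W"
  shows "J_st M W = (\<Sum>j\<in>UNIV. if integrable M (\<lambda>\<omega>. (std_score j (W \<omega>))\<^sup>2)
    then ereal (\<integral>\<omega>. (std_score j (W \<omega>))\<^sup>2 \<partial>M) else \<infinity>)"
proof -
  define Z where "Z \<omega> = \<rho> (W \<omega>) + W \<omega>" for \<omega>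
  have [measurable]: "Z \<in> borel_measurable M" unfolding Z_def by measurable
  have Zj: "Z \<omega> $ j = std_score j (W \<omega>)" for \<omega> j by (simp add: Z_def std_score_def)
  have inv: "matrix_inv (mat 1 :: real^'d^'d) = mat 1"
    unfolding matrix_inv_def by (rule some_equality) simp_all
  have fi: "fisher_integrand M W = (\<lambda>\<omega>. outer (Z \<omega>) (Z \<omega>))"
    by (auto simp: fisher_integrand_def cov inv Z_def \<rho> Let_def)
  have int: "integrable M (fisher_integrand M W) \<longleftrightarrow> (\<forall>j. integrable M (\<lambda>\<omega>. (std_score j (W \<omega>))\<^sup>2))"
    unfolding fi by (subst integrable_outer_iff) (simp_all add: Zj)
  show ?thesis
  proof (cases "integrable M (fisher_integrand M W)")
    case True
    have "trace (covariance_matrix M W ** rel_fisher_info M W) = (\<Sum>j\<in>UNIV. rel_fisher_info M W $ j $ j)"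
      by (simp add: cov trace_def)
    also have "\<dots> = (\<Sum>j\<in>UNIV. \<integral>\<omega>. (std_score j (W \<omega>))\<^sup>2 \<partial>M)"
      using integral_matrix_nth[OF True] unfolding rel_fisher_info_def
      by (simp add: fi outer_def Zj power2_eq_square)
    finally show ?thesis using True int by (simp add: J_st_def)
  next
    case False
    then obtain j where "\<not> integrable M (\<lambda>\<omega>. (std_score j (W \<omega>))\<^sup>2)" using int by blast
    then have "(\<Sum>j\<in>UNIV. if integrable M (\<lambda>\<omega>. (std_score j (W \<omega>))\<^sup>2)
      then ereal (\<integral>\<omega>. (std_score j (W \<omega>))\<^sup>2 \<partial>M) else \<infinity>) = \<infinity>"
      unfolding sum_Pinfty by auto
    then show ?thesis using False by (simp add: J_st_def)
  qed
qed

section \<open>Moments of the normalized sum\<close>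

lemma (in prob_space) covariance_matrix_centered:
  fixes Y :: "'a \<Rightarrow> real^'d::finite"
  assumes Y: "Y \<in> borel_measurable M" "\<And>k. integrable M (\<lambda>\<omega>. (Y \<omega> $ k)\<^sup>2)" "integral\<^sup>L M Y = 0"
  shows "covariance_matrix M Y $ k $ l = (\<integral>\<omega>. Y \<omega> $ k * Y \<omega> $ l \<partial>M)"
proof -
  have "integrable M (\<lambda>\<omega>. outer (Y \<omega>) (Y \<omega>))" using Y by (simp add: integrable_outer_iff)
  from integral_matrix_nth[OF this, of k l] show ?thesis
    unfolding covariance_matrix_def using Y(3) by (simp add: outer_def)
qed

text \<open>Independence and centring remove the mixed terms i \<noteq> j of the double sum; the n
  remaining identity matrices are balanced by the factor 1/n.\<close>

lemma (in prob_space) normalized_sum_moments: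
  fixes X :: "nat \<Rightarrow> 'a \<Rightarrow> real^'d::finite"
  assumes n: "n \<ge> 1" and ind: "indep_vars (\<lambda>_. borel) X {1..n}"
    and sq: "\<And>i. i \<in> {1..n} \<Longrightarrow> integrable M (\<lambda>\<omega>. (norm (X i \<omega>))\<^sup>2)"
    and mean: "\<And>i. i \<in> {1..n} \<Longrightarrow> integral\<^sup>L M (X i) = 0"
    and cov: "\<And>i. i \<in> {1..n} \<Longrightarrow> covariance_matrix M (X i) = mat 1"
  shows "normalized_sum n X \<in> borel_measurable M"
    and "integrable M (\<lambda>\<omega>. (normalized_sum n X \<omega> $ k)\<^sup>2)"
    and "(\<integral>\<omega>. normalized_sum n X \<omega> $ k \<partial>M) = 0"
    and "covariance_matrix M (normalized_sum n X) = mat 1"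
proof -
  let ?W = "normalized_sum n X"
  have Xm: "X i \<in> borel_measurable M" if "i \<in> {1..n}" for i
    using ind that by (auto simp: indep_vars_def)
  have Xsq: "integrable M (\<lambda>\<omega>. (X i \<omega> $ k)\<^sup>2)" if "i \<in> {1..n}" for i k
    by (rule integrable_component_square[OF Xm[OF that] sq[OF that]])
  have Xi: "integrable M (\<lambda>\<omega>. X i \<omega> $ k)" if "i \<in> {1..n}" for i k
    by (rule integrable_of_square[OF borel_measurable_vec_nth[OF Xm[OF that]] Xsq[OF that]])
  have X0: "(\<integral>\<omega>. X i \<omega> $ k \<partial>M) = 0" if "i \<in> {1..n}" for i k
    using integral_vec_nth[of M "X i" k] Xi[OF that] mean[OF that] by (simp add: integrable_vec_iff)
  have XXi: "integrable M (\<lambda>\<omega>. X i \<omega> $ k * X j \<omega> $ l)" if "i \<in> {1..n}" "j \<in> {1..n}" for i j k l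
    using that by (intro integrable_mult_of_squares Xsq borel_measurable_vec_nth Xm)
  have XX: "(\<integral>\<omega>. X i \<omega> $ k * X j \<omega> $ l \<partial>M) = (if i = j then mat 1 $ k $ l else 0)"
    if ij: "i \<in> {1..n}" "j \<in> {1..n}" for i j k l
  proof (cases "i = j")
    case True
    then show ?thesis
      using covariance_matrix_centered[OF Xm[OF ij(1)] Xsq[OF ij(1)] mean[OF ij(1)], of k l] cov[OF ij(1)]
      by simp
  next
    case False
    have "indep_var borel ((\<lambda>x. x $ k) \<circ> X i) borel ((\<lambda>x. x $ l) \<circ> X j)"
      by (rule indep_var_compose[OF indep_vars_indep_var[OF ind ij False]]) measurable
    then have "indep_var borel (\<lambda>\<omega>. X i \<omega> $ k) borel (\<lambda>\<omega>. X j \<omega> $ l)" by (simp add: o_def)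
    from indep_var_lebesgue_integral[OF this Xi[OF ij(1)] Xi[OF ij(2)]]
    show ?thesis using False X0[OF ij(1)] by simp
  qed
  have Wk: "?W \<omega> $ k = (1 / sqrt (real n)) * (\<Sum>i\<in>{1..n}. X i \<omega> $ k)" for \<omega> k
    by (simp add: normalized_sum_def)
  have "(\<lambda>\<omega>. (1 / sqrt (real n)) *\<^sub>R (\<Sum>i\<in>{1..n}. X i \<omega>)) \<in> borel_measurable M"
    by (intro borel_measurable_scaleR borel_measurable_sum borel_measurable_const Xm)
  then show Wm: "?W \<in> borel_measurable M"
    by (simp add: normalized_sum_def[abs_def])
  have WW: "?W \<omega> $ k * ?W \<omega> $ l = (1 / real n) * (\<Sum>i\<in>{1..n}. \<Sum>j\<in>{1..n}. X i \<omega> $ k * X j \<omega> $ l)" for \<omega> k l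
    by (simp add: Wk sum_product)
  have WWi: "integrable M (\<lambda>\<omega>. ?W \<omega> $ k * ?W \<omega> $ l)" for k l
    unfolding WW by (intro integrable_mult_right Bochner_Integration.integrable_sum XXi)
  show Wsq: "integrable M (\<lambda>\<omega>. (?W \<omega> $ k)\<^sup>2)" for k
    using WWi[of k k] by (simp add: power2_eq_square)
  show W0: "(\<integral>\<omega>. ?W \<omega> $ k \<partial>M) = 0" for k
    unfolding Wk using Xi X0 by (simp add: Bochner_Integration.integral_sum)
  have "integrable M ?W"
    unfolding integrable_vec_iff
    by (rule allI) (rule integrable_of_square[OF borel_measurable_vec_nth[OF Wm] Wsq])
  then have "integral\<^sup>L M ?W = 0" by (simp add: vec_eq_iff integral_vec_nth W0)
  note C = covariance_matrix_centered[OF Wm Wsq this]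
  have "(\<integral>\<omega>. ?W \<omega> $ k * ?W \<omega> $ l \<partial>M) = (mat 1 :: real^'d^'d) $ k $ l" for k l
  proof -
    have "(\<integral>\<omega>. (\<Sum>i\<in>{1..n}. \<Sum>j\<in>{1..n}. X i \<omega> $ k * X j \<omega> $ l) \<partial>M)
      = (\<Sum>i\<in>{1..n}. \<integral>\<omega>. (\<Sum>j\<in>{1..n}. X i \<omega> $ k * X j \<omega> $ l) \<partial>M)"
      by (intro Bochner_Integration.integral_sum Bochner_Integration.integrable_sum XXi)
    also have "\<dots> = (\<Sum>i\<in>{1..n}. \<Sum>j\<in>{1..n}. \<integral>\<omega>. X i \<omega> $ k * X j \<omega> $ l \<partial>M)"
      by (intro sum.cong refl Bochner_Integration.integral_sum XXi)
    finally have "(\<integral>\<omega>. ?W \<omega> $ k * ?W \<omega> $ l \<partial>M)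
      = (1 / real n) * (\<Sum>i\<in>{1..n}. \<Sum>j\<in>{1..n}. \<integral>\<omega>. X i \<omega> $ k * X j \<omega> $ l \<partial>M)"
      unfolding WW by (simp only: integral_mult_right_zero)
    also have "\<dots> = (1 / real n) * (\<Sum>i\<in>{1..n}. \<Sum>j\<in>{1..n}. if i = j then mat 1 $ k $ l else 0)"
      by (simp add: XX)
    also have "\<dots> = (mat 1 :: real^'d^'d) $ k $ l"
      using n by simp
    finally show ?thesis .
  qed
  then show "covariance_matrix M ?W = mat 1"
    by (simp add: vec_eq_iff C)
qed

text \<open>The first conjunct ensures that the choice \<open>score M W\<close> is an actual score.
  The equation is one of extended reals and includes the case that some Z_j is not square
  integrable, where both sides are infinite.\<close>

theorem mainTheorem6:
  fixes M :: "'a measure"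
    and n :: nat
    and X :: "nat \<Rightarrow> 'a \<Rightarrow> real^'d::finite"
    and \<tau> :: "nat \<Rightarrow> real^'d \<Rightarrow> real^'d^'d"
    and \<rho> :: "nat \<Rightarrow> real^'d \<Rightarrow> real^'d"
    and W :: "'a \<Rightarrow> real^'d"
  assumes "prob_space M"
    and "n \<ge> 1"
    and "prob_space.indep_vars M (\<lambda>_. borel) X {1..n}"
    and "\<And>i. i \<in> {1..n} \<Longrightarrow> \<exists>f. distributed M lborel (X i) f"
    and "\<And>i. i \<in> {1..n} \<Longrightarrow> integrable M (\<lambda>\<omega>. (norm (X i \<omega>))\<^sup>2)"
    and "\<And>i. i \<in> {1..n} \<Longrightarrow> integral\<^sup>L M (X i) = 0"
    and "\<And>i. i \<in> {1..n} \<Longrightarrow> covariance_matrix M (X i) = mat 1"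
    and "\<And>i. i \<in> {1..n} \<Longrightarrow> is_stein_matrix M (X i) (\<tau> i)"
    and "\<And>i. i \<in> {1..n} \<Longrightarrow> is_score M (X i) (\<rho> i)"
    and W: "W = normalized_sum n X"
  shows "(\<exists>\<rho>W. is_score M W \<rho>W) \<and>
    J_st M W =
      (\<Sum>j\<in>UNIV. SUP \<phi>\<in>H_class M W.
         ereal ((integral\<^sup>L M (\<lambda>\<omega>. partial_deriv j \<phi> (W \<omega>) - (W \<omega>) $ j * \<phi> (W \<omega>)))\<^sup>2))"
proof -
  interpret prob_space M by fact
  \<comment> \<open>One summand is split off to supply the score and the density; for n = 1 the
    remaining sum is empty and equals 0.\<close>
  have one: "1 \<in> {1..n}" and ins: "{1..n} = insert 1 {2..n}" using \<open>n \<ge> 1\<close> by auto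
  have ind1: "indep_var borel (X 1) borel (\<lambda>\<omega>. \<Sum>i\<in>{2..n}. X i \<omega>)"
    using assms(3) unfolding ins by (intro indep_vars_vector_sum) auto
  have c: "1 / sqrt (real n) \<noteq> 0" using \<open>n \<ge> 1\<close> by simp
  have W_eq: "W = (\<lambda>\<omega>. (1 / sqrt (real n)) *\<^sub>R (X 1 \<omega> + (\<Sum>i\<in>{2..n}. X i \<omega>)))"
    unfolding W normalized_sum_def[abs_def] ins by simp
  have ex: "\<exists>\<rho>W. is_score M W \<rho>W"
    unfolding W_eq by (rule is_score_indep_sum[OF ind1 assms(9)[OF one] c])
  obtain p where "distributed M lborel (X 1) p" using assms(4)[OF one] by blast
  from density_indep_sum[OF ind1 this c] obtain f where
    f: "f \<in> borel_measurable borel" "\<And>x. 0 \<le> f x" "distr M borel W = density lborel (\<lambda>x. ennreal (f x))"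
    unfolding W_eq by blast
  note mom = normalized_sum_moments[OF assms(2,3,5,6,7), folded W]
  have sc: "is_score M W (score M W)"
    unfolding score_def by (rule someI_ex[OF ex])
  interpret score_density M W f "score M W"
    by unfold_locales (use f mom sc in auto)
  show ?thesis
    using ex J_st_eq[OF mom(4) refl] SUP_stein_value unfolding stein_value_def by simp
qed

end
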